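(* There is an absolute constant $C>0$ such that for every integer $r\ge 3$, $$1-\frac1r-C\,\frac{\ln r}{r^2\ln\ln r}\;\le\;\frac{a(\mathrm{PSG}_r)}{r!}\;\le\;1-\frac1r-\frac{\varphi(r)}{r!}.$$ Hence, with such a constant, the threshold for growing paths in $r$-uniform tournaments is in the range $$\left[\left(1-\frac1r-C\,\frac{\ln r}{r^2\ln\ln r}\right)r!,\ \left(1-\frac1r-\frac{\varphi(r)-1}{r!}\right)r!\right].$$
   Context: An $r$-digraph $G$ consists of a finite vertex set $V(G)$ and an edge set $E(G)$ whose elements are ordered lists of $r$ distinct vertices. An $(r,k)$-tournament ($0\le k\le r!$) is an $r$-digraph $G$ such that for every $r$-element set $S\subseteq V(G)$, exactly $k$ of the $r!$ orderings of $S$ are edges of $G$. The tight path $P^{(r)}_s$ is the $r$-digraph with $s$ distinct vertices $v_1,\ldots,v_s$ whose edges are exactly the lists of $r$ consecutive vertices $(v_i,\ldots,v_{i+r-1})$, $1\le i\le s-r+1$ (no edges if $s<r$). An $r$-digraph $G$ contains $P^{(r)}_s$ if there is an injection of its vertices into $V(G)$ mapping edges to edges. $f(n,r,k)$ is the maximum integer $s$ such that every $n$-vertex $(r,k)$-tournament contains a copy of $P^{(r)}_s$. The threshold for growing paths (in $r$-uniform tournaments) is the minimum $k$ such that $f(n,r,k)\to\infty$ as $n\to\infty$. Two lists $(a_1,\ldots,a_s)$ and $(b_1,\ldots,b_s)$, each with distinct entries, pattern-match if for all $i<j$ we have $a_i<a_j$ if and only if $b_i<b_j$. The pattern-shift graph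 $\mathrm{PSG}_r$ is the digraph (loops allowed) whose vertices are the permutations of $[r]=\{1,\ldots,r\}$ written as lists, with an edge from $a$ to $b$ (possibly $a=b$) if and only if the list of the last $r-1$ entries of $a$ and the list of the first $r-1$ entries of $b$ pattern-match. For a digraph $G$, $a(G)$ is the maximum size of a set of vertices inducing an acyclic subgraph, i.e. one with no directed cycle (loops count as cycles of length 1, and directed 2-cycles count as cycles). $\varphi$ is the Euler totient function, $\varphi(r)=|\{d\in[r]:\gcd(d,r)=1\}|$. *)

theory Defs
  imports Complex_Main "HOL-Combinatorics.Multiset_Permutations" "HOL-Number_Theory.Totient"
begin

section \<open>Uniform directed hypergraphs, tournaments and tight paths\<close>

record 'a hyperdigraph =
  verts :: "'a set"
  edges :: "'a list set"

definition r_digraph :: "nat \<Rightarrow> 'a hyperdigraph \<Rightarrow> bool" where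
  "r_digraph r G \<longleftrightarrow> finite (verts G) \<and>
     (\<forall>e\<in>edges G. length e = r \<and> distinct e \<and> set e \<subseteq> verts G)"

definition tournament :: "nat \<Rightarrow> nat \<Rightarrow> 'a hyperdigraph \<Rightarrow> bool" where
  "tournament r k G \<longleftrightarrow> k \<le> fact r \<and> r_digraph r G \<and>
     (\<forall>S. S \<subseteq> verts G \<and> card S = r \<longrightarrow> card (permutations_of_set S \<inter> edges G) = k)"

definition tight_path :: "nat \<Rightarrow> nat \<Rightarrow> nat hyperdigraph" where
  "tight_path r s = \<lparr>verts = {1..s}, edges = {[i..<i + r] | i. 1 \<le> i \<and> i + r \<le> s + 1}\<rparr>"

definition contains_copy :: "'a hyperdigraph \<Rightarrow> 'b hyperdigraph \<Rightarrow> bool" where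
  "contains_copy G H \<longleftrightarrow>
     (\<exists>g. inj_on g (verts H) \<and> g ` verts H \<subseteq> verts G \<and> (\<forall>e\<in>edges H. map g e \<in> edges G))"

text \<open>Vertex sets are finite, so it is no restriction to take the vertices to be natural numbers.
  For \<open>r \<ge> 1\<close> and \<open>k \<le> fact r\<close> tournaments on \<open>n\<close> vertices exist, and the set below contains
  \<open>0\<close> and is bounded by \<open>n\<close>, so that \<open>Max\<close> is meaningful.\<close>

definition path_number :: "nat \<Rightarrow> nat \<Rightarrow> nat \<Rightarrow> nat" where
  "path_number n r k =
     Max {s. \<forall>G :: nat hyperdigraph.
               tournament r k G \<and> card (verts G) = n \<longrightarrow> contains_copy G (tight_path r s)}"

text \<open>The bound \<open>k \<le> fact r\<close> is the range in which tournaments are defined.  The minimum is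
  attained, because \<open>path_number n r (fact r) = n\<close> for \<open>r \<ge> 1\<close>.\<close>

definition growing_threshold :: "nat \<Rightarrow> nat" where
  "growing_threshold r =
     (LEAST k. k \<le> fact r \<and> filterlim (\<lambda>n. path_number n r k) at_top at_top)"

section \<open>The pattern-shift graph\<close>

text \<open>Intended for lists with distinct entries.\<close>

definition pattern_match :: "nat list \<Rightarrow> nat list \<Rightarrow> bool" where
  "pattern_match a b \<longleftrightarrow> length a = length b \<and>
     (\<forall>i j. i < j \<and> j < length a \<longrightarrow> (a ! i < a ! j \<longleftrightarrow> b ! i < b ! j))"

definition PSG_verts :: "nat \<Rightarrow> nat list set" where
  "PSG_verts r = permutations_of_set {1..r}"

definition PSG_edges :: "nat \<Rightarrow> (nat list \<times> nat list) set" where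
  "PSG_edges r = {(a, b). a \<in> PSG_verts r \<and> b \<in> PSG_verts r \<and>
     pattern_match (drop 1 a) (take (r - 1) b)}"

definition max_acyclic :: "'a set \<Rightarrow> ('a \<times> 'a) set \<Rightarrow> nat" where
  "max_acyclic V E = Max {card S | S. S \<subseteq> V \<and> acyclic (E \<inter> S \<times> S)}"

end

theory Submission
  imports Defs "HOL-Library.Ramsey" "HOL-Real_Asymp.Real_Asymp"
begin

text \<open>
  Threshold: by Ramsey's theorem a large tournament contains a large set on which the set of patterns
  of the edges is constant; if this set of \<open>k\<close> patterns spans a cycle of the pattern-shift graph, walking
  around the cycle yields arbitrarily long tight paths. Conversely, an acyclic set of patterns defines
  tournaments whose tight paths are short. So the threshold is one more than the maximum size of an
  acyclic set.

  Upper bound: the rotations of a permutation form a cycle, which gives \<open>(r - 1)!\<close> disjoint cycles;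
  for \<open>d\<close> coprime to \<open>r\<close> the class of the progressions \<open>c + d * i\<close> modulo \<open>r\<close> splits further into two cycles.

  Lower bound: give every window of length \<open>2 * n + 4\<close> of a permutation a score from a bounded range, and
  delete the permutations whose first window has the maximal score of all windows. In a walk through the
  remaining permutations each window is followed by one with a larger score, so there are no cycles.
  Windows of positive score cannot overlap (up to rare events) and ties are rare, so a typical rotation
  class contains at most one deleted permutation. This gives the error term \<open>O(1 / r\<^sup>2)\<close>.
\<close>

section \<open>The threshold and the pattern-shift graph\<close>

text \<open>Both bounds count how many permutations must be removed to meet every cycle. Rotation
  classes force a fraction 1/r, so the lower bound needs a removal rule that takes hardly more than
  one member of each class and still meets the cycles that are not rotations. Comparisons inside a
  window suit both tasks: an edge keeps all comparisons among the surviving entries, so a score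
  travels unchanged to the front, and a window of a permutation is seen again in its rotations. The
  weak points are permutations without any mark, overlapping marks and equal scores; these are the
  exceptional permutations. The window length is of order r^(1/8). It must exceed a multiple of ln
  r, since about r events of probability 2^-n have to stay below 1/r^2 together, and it must be well
  below r^(1/5), since a block of length L is marked with probability at least L^-4 and there are
  only about r/L disjoint blocks. All probabilities are obtained by counting injective images under
  permutations of positions.\<close>

lemma PSG_verts_iff: "xs \<in> PSG_verts r \<longleftrightarrow> set xs = {1..r} \<and> distinct xs"
  by (auto simp: PSG_verts_def permutations_of_set_def)

lemma PSG_verts_length: "xs \<in> PSG_verts r \<Longrightarrow> length xs = r"
  by (metis PSG_verts_iff card_atLeastAtMost diff_Suc_1 distinct_card)

lemma finite_PSG_verts [simp]: "finite (PSG_verts r)"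
  by (simp add: PSG_verts_def)

lemma card_PSG_verts: "card (PSG_verts r) = fact r"
  by (simp add: PSG_verts_def)

text \<open>Entries are distinct, so the comparisons for i < j decide the reverse ones too. Without
  the restriction i < j the condition can be applied to any pair of positions.\<close>

lemma PSG_edges_iff:
  "(a, b) \<in> PSG_edges r \<longleftrightarrow> a \<in> PSG_verts r \<and> b \<in> PSG_verts r \<and>
     (\<forall>i j. Suc i < r \<and> Suc j < r \<longrightarrow> (a ! Suc i < a ! Suc j \<longleftrightarrow> b ! i < b ! j))"
proof (cases "a \<in> PSG_verts r \<and> b \<in> PSG_verts r")
  case True
  then have ab: "a \<in> PSG_verts r" "b \<in> PSG_verts r" by auto
  then have l: "length a = r" "length b = r" and d: "distinct a" "distinct b"
    by (auto simp: PSG_verts_length PSG_verts_iff)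
  have pm: "pattern_match (drop 1 a) (take (r - 1) b) \<longleftrightarrow>
      (\<forall>i j. i < j \<and> Suc j < r \<longrightarrow> (a ! Suc i < a ! Suc j \<longleftrightarrow> b ! i < b ! j))"
    unfolding pattern_match_def using l
    by (auto simp: less_diff_conv)
  have "(\<forall>i j. i < j \<and> Suc j < r \<longrightarrow> (a ! Suc i < a ! Suc j \<longleftrightarrow> b ! i < b ! j)) \<longleftrightarrow>
     (\<forall>i j. Suc i < r \<and> Suc j < r \<longrightarrow> (a ! Suc i < a ! Suc j \<longleftrightarrow> b ! i < b ! j))" (is "?l \<longleftrightarrow> ?r")
  proof
    assume L: ?l
    show ?r
    proof (intro allI impI, elim conjE)
      fix i j assume ij: "Suc i < r" "Suc j < r"
      consider "i < j" | "i = j" | "j < i" by linarith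
      then show "a ! Suc i < a ! Suc j \<longleftrightarrow> b ! i < b ! j"
      proof cases
        case 3
        then have "a ! Suc j < a ! Suc i \<longleftrightarrow> b ! j < b ! i" using L ij by blast
        moreover have "a ! Suc j \<noteq> a ! Suc i" using 3 ij l d by (simp add: nth_eq_iff_index_eq)
        moreover have "b ! j \<noteq> b ! i" using 3 ij l d by (simp add: nth_eq_iff_index_eq)
        ultimately show ?thesis by linarith
      qed (use L ij in auto)
    qed
  qed (meson Suc_lessD Suc_less_eq less_trans)
  then show ?thesis using ab pm by (simp add: PSG_edges_def)
qed (auto simp: PSG_edges_def)

subsection \<open>Standardization\<close>

text \<open>The pattern of a list. It is defined over every linear order because it is applied both
  to vertices of tournaments and to the real sequences of \<open>realize_walk\<close>.\<close>

definition std :: "'a::linorder list \<Rightarrow> nat list" where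
  "std e = map (\<lambda>x. card {y \<in> set e. y \<le> x}) e"

lemma length_std [simp]: "length (std e) = length e"
  by (simp add: std_def)

lemma std_less_iff:
  assumes "i < length e" "j < length e"
  shows "std e ! i < std e ! j \<longleftrightarrow> e ! i < e ! j"
proof -
  have mono: "card {z \<in> set e. z \<le> x} < card {z \<in> set e. z \<le> y}" if "x < y" "y \<in> set e" for x y
  proof (rule psubset_card_mono)
    show "{z \<in> set e. z \<le> x} \<subset> {z \<in> set e. z \<le> y}" using that by force
  qed auto
  show ?thesis
    using mono[of "e ! i" "e ! j"] mono[of "e ! j" "e ! i"] assms
    by (cases "e ! i" "e ! j" rule: linorder_cases) (auto simp: std_def)
qed

lemma std_in_PSG_verts:
  assumes "distinct e" shows "std e \<in> PSG_verts (length e)"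
proof -
  have inj: "inj_on ((!) (std e)) {..<length e}"
  proof (rule inj_onI)
    fix i j assume ij: "i \<in> {..<length e}" "j \<in> {..<length e}" "std e ! i = std e ! j"
    then have "\<not> e ! i < e ! j" "\<not> e ! j < e ! i" using std_less_iff[of _ e] by force+
    then show "i = j" using assms ij by (simp add: nth_eq_iff_index_eq)
  qed
  then have d: "distinct (std e)" by (simp add: distinct_conv_nth inj_on_def) blast
  have "set (std e) \<subseteq> {1..length e}"
  proof
    fix v assume "v \<in> set (std e)"
    then obtain x where x: "x \<in> set e" "v = card {y \<in> set e. y \<le> x}" by (auto simp: std_def)
    have "v \<le> card (set e)" unfolding x by (rule card_mono) auto
    moreover have "0 < v" unfolding x using x(1) by (subst card_gt_0_iff) auto
    ultimately show "v \<in> {1..length e}" using distinct_card[OF assms] by auto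
  qed
  moreover have "card (set (std e)) = length e" using distinct_card[OF d] by simp
  ultimately have "set (std e) = {1..length e}" by (intro card_subset_eq) auto
  with d show ?thesis by (simp add: PSG_verts_iff)
qed

lemma std_cong:
  fixes e :: "'a::linorder list" and p :: "'b::linorder list"
  assumes len: "length e = length p" and "distinct e" "distinct p"
    and ord: "\<And>i j. i < length p \<Longrightarrow> j < length p \<Longrightarrow> e ! i < e ! j \<longleftrightarrow> p ! i < p ! j"
  shows "std e = std p"
proof (rule nth_equalityI)
  fix i assume i: "i < length (std e)"
  \<comment> \<open>Counting positions instead of values expresses a rank through comparisons of
    entries alone, which makes lists over two different types comparable.\<close>
  have *: "std q ! i = card {j. j < length q \<and> q ! j \<le> q ! i}"
    if "distinct q" "i < length q" for q :: "'c::linorder list"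
  proof -
    have "{y \<in> set q. y \<le> q ! i} = (!) q ` {j. j < length q \<and> q ! j \<le> q ! i}"
      by (auto simp: in_set_conv_nth)
    moreover have "inj_on ((!) q) {j. j < length q \<and> q ! j \<le> q ! i}"
      using that by (auto simp: inj_on_def nth_eq_iff_index_eq)
    ultimately show ?thesis using that by (simp add: std_def card_image)
  qed
  have "{j. j < length e \<and> e ! j \<le> e ! i} = {j. j < length p \<and> p ! j \<le> p ! i}"
    using len i ord[of i] by (auto simp: not_less[symmetric])
  then show "std e ! i = std p ! i" using *[of e] *[of p] assms i by simp
qed (use len in simp)

lemma std_PSG_verts: "p \<in> PSG_verts r \<Longrightarrow> std p = p"
proof -
  assume p: "p \<in> PSG_verts r"
  have "card {y \<in> set p. y \<le> x} = x" if "x \<in> set p" for x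
  proof -
    have "{y \<in> set p. y \<le> x} = {1..x}" using p that by (auto simp: PSG_verts_iff)
    then show ?thesis by simp
  qed
  then show "std p = p" by (simp add: std_def map_idI)
qed

lemma std_eqI:
  assumes "p \<in> PSG_verts r" "length e = r" "distinct e"
    "\<And>i j. i < r \<Longrightarrow> j < r \<Longrightarrow> e ! i < e ! j \<longleftrightarrow> p ! i < p ! j"
  shows "std e = p"
  using std_cong[of e p] assms PSG_verts_length[OF assms(1)] std_PSG_verts[OF assms(1)]
  by (auto simp: PSG_verts_iff)

text \<open>All orderings of one set are standardized by the same injective rank function. Hence
  inside a fixed vertex set an edge can be recovered from its pattern.\<close>

lemma inj_on_std: "inj_on std (permutations_of_set S)"
proof (rule inj_onI)
  fix e e' :: "'a list"
  assume e: "e \<in> permutations_of_set S" "e' \<in> permutations_of_set S" "std e = std e'"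
  define f where "f x = card {y \<in> S. y \<le> x}" for x
  have fin: "finite S" using e(1) by (auto simp: permutations_of_set_def)
  have "inj_on f S"
  proof (rule linorder_inj_onI')
    fix x y assume "x \<in> S" "y \<in> S" "x < y"
    then have "{z \<in> S. z \<le> x} \<subset> {z \<in> S. z \<le> y}" by force
    then have "f x < f y" unfolding f_def using fin by (intro psubset_card_mono) auto
    then show "f x \<noteq> f y" by simp
  qed
  moreover have "map f e = map f e'"
    using e unfolding std_def f_def by (simp add: permutations_of_set_def)
  moreover have "set e = S" "set e' = S" using e by (auto simp: permutations_of_set_def)
  ultimately show "e = e'" by (metis inj_on_map_eq_map sup.idem)
qed

lemma std_image_permutations_of_set:
  assumes "finite S" "card S = r"
  shows "std ` permutations_of_set S = PSG_verts r"
proof (rule card_subset_eq)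
  show "std ` permutations_of_set S \<subseteq> PSG_verts r"
  proof safe
    fix e assume "e \<in> permutations_of_set S"
    then have "distinct e" "length e = r" using assms
      by (auto simp: permutations_of_set_def distinct_card)
    then show "std e \<in> PSG_verts r" using std_in_PSG_verts by blast
  qed
  show "card (std ` permutations_of_set S) = card (PSG_verts r)"
    using assms by (simp add: card_image[OF inj_on_std] card_PSG_verts)
qed simp

lemma std_consecutive_PSG_edges:
  assumes "distinct zs" "length zs = Suc r"
  shows "(std (take r zs), std (drop 1 zs)) \<in> PSG_edges r"
proof -
  have "std (take r zs) \<in> PSG_verts r" "std (drop 1 zs) \<in> PSG_verts r"
    using std_in_PSG_verts[of "take r zs"] std_in_PSG_verts[of "drop 1 zs"] assms by auto
  then show ?thesis using assms by (auto simp: PSG_edges_iff std_less_iff)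
qed

subsection \<open>Maximum acyclic sets\<close>

lemma max_acyclic_witness:
  assumes "finite V"
  obtains S where "S \<subseteq> V" "acyclic (E \<inter> S \<times> S)" "card S = max_acyclic V E"
proof -
  have fin: "finite {card S | S. S \<subseteq> V \<and> acyclic (E \<inter> S \<times> S)}" using assms by simp
  have "card {} \<in> {card S | S. S \<subseteq> V \<and> acyclic (E \<inter> S \<times> S)}"
    by (intro CollectI exI[of _ "{}"]) (simp add: acyclic_def)
  then have "max_acyclic V E \<in> {card S | S. S \<subseteq> V \<and> acyclic (E \<inter> S \<times> S)}"
    unfolding max_acyclic_def using fin Max_in by blast
  then show thesis using that by auto
qed

lemma max_acyclic_ge:
  assumes "finite V" "S \<subseteq> V" "acyclic (E \<inter> S \<times> S)"
  shows "card S \<le> max_acyclic V E"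
  unfolding max_acyclic_def using assms by (intro Max_ge) auto

text \<open>Take the vertices mutually reachable with a point on a cycle. A walk in this set never
  gets stuck, which is all that is needed of a cycle, here and for the hitting set.\<close>

lemma not_acyclic_core:
  assumes "\<not> acyclic R"
  obtains A where "A \<noteq> {}" "A \<subseteq> Field R" "\<And>b. b \<in> A \<Longrightarrow> \<exists>c\<in>A. (b, c) \<in> R"
proof -
  obtain a where a: "(a, a) \<in> R\<^sup>+" using assms by (auto simp: acyclic_def)
  define A where "A = {b. (a, b) \<in> R\<^sup>+ \<and> (b, a) \<in> R\<^sup>+}"
  show thesis
  proof (rule that)
    show "A \<noteq> {}" using a by (auto simp: A_def)
    show "A \<subseteq> Field R"
      using trancl_domain[of R] by (fastforce simp: A_def Field_def)
    fix b assume b: "b \<in> A"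
    then have "(a, b) \<in> R\<^sup>+" "(b, a) \<in> R\<^sup>+" by (auto simp: A_def)
    then obtain c where c: "(b, c) \<in> R" "(c, a) \<in> R\<^sup>*" by (meson tranclD)
    have "(a, c) \<in> R\<^sup>+" using \<open>(a, b) \<in> R\<^sup>+\<close> c by simp
    moreover have "(c, a) \<in> R\<^sup>+" using c a by (meson rtrancl_trancl_trancl)
    ultimately show "\<exists>c\<in>A. (b, c) \<in> R" using c by (auto simp: A_def)
  qed
qed

subsection \<open>Realizing walks\<close>

lemma finite_separation_real:
  fixes A B F :: "real set"
  assumes "finite A" "finite B" "finite F" "\<And>a b. a \<in> A \<Longrightarrow> b \<in> B \<Longrightarrow> a < b"
  obtains y where "y \<notin> F" "\<And>a. a \<in> A \<Longrightarrow> a < y" "\<And>b. b \<in> B \<Longrightarrow> y < b"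
proof -
  \<comment> \<open>The added points make both sides nonempty, so that \<open>Max\<close> and
    \<open>Min\<close> are meaningful also when \<open>A\<close> or \<open>B\<close> is
    empty.\<close>
  define A' where "A' = insert (Min (insert 0 B) - 1) A"
  have A': "finite A'" "A' \<noteq> {}" "A \<subseteq> A'" using assms by (auto simp: A'_def)
  have lt: "a < b" if "a \<in> A'" "b \<in> B" for a b
  proof -
    have "Min (insert 0 B) \<le> b" using that assms by (intro Min_le) auto
    then have "Min (insert 0 B) - 1 < b" by linarith
    then show ?thesis using that assms(4) unfolding A'_def by blast
  qed
  define B' where "B' = insert (Max A' + 1) B"
  have B': "finite B'" "B' \<noteq> {}" "B \<subseteq> B'" using assms by (auto simp: B'_def)
  have "Max A' \<in> A'" using A' by simp
  then have "Max A' < b" if "b \<in> B'" for b using that lt unfolding B'_def by force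
  then have "Max A' < Min B'" using Min_in[OF B'(1,2)] by blast
  then have "infinite {Max A'<..<Min B'}" by simp
  then have "{Max A'<..<Min B'} - F \<noteq> {}" using assms(3) by (metis finite.emptyI finite_Diff2)
  then obtain y where "y \<in> {Max A'<..<Min B'} - F" by blast
  then have y: "Max A' < y" "y < Min B'" "y \<notin> F" by auto
  show thesis
  proof (rule that[of y])
    show "a < y" if "a \<in> A" for a using that y A' by (meson Max_ge le_less_trans subsetD)
    show "y < b" if "b \<in> B" for b using that y B' by (meson Min_le less_le_trans subsetD)
  qed fact
qed

text \<open>The edge already fixes the pattern of the r - 1 shared entries; only the rank of the new
  entry is open. Over the reals every rank leaves a gap, so old entries are never relabelled. The
  set \<open>F\<close> will hold all earlier entries, which keeps the whole sequence distinct and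
  not only its last window.\<close>

lemma extend_realization:
  fixes u :: "real list"
  assumes u: "distinct u" "length u = r" "r > 0" and edge: "(std u, p) \<in> PSG_edges r"
    and F: "finite F"
  obtains y where "y \<notin> F" "std (tl u @ [y]) = p" 
proof -
  define w where "w = tl u"
  have w: "length w = r - 1" "distinct w" "\<And>i. Suc i < r \<Longrightarrow> w ! i = u ! Suc i"
    using u by (auto simp: w_def distinct_tl nth_tl)
  have p: "p \<in> PSG_verts r" using edge by (simp add: PSG_edges_iff)
  then have lp: "length p = r" "distinct p" by (auto simp: PSG_verts_length PSG_verts_iff)
  have ord: "w ! i < w ! j \<longleftrightarrow> p ! i < p ! j" if "Suc i < r" "Suc j < r" for i j
    using edge that u w(3) by (auto simp: PSG_edges_iff std_less_iff)
  define A where "A = {w ! i | i. Suc i < r \<and> p ! i < p ! (r - 1)}"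
  define B where "B = {w ! i | i. Suc i < r \<and> p ! (r - 1) < p ! i}"
  have "finite {i. Suc i < r}" by (rule finite_subset[of _ "{..<r}"]) auto
  then have fin: "finite A" "finite B" by (auto simp: A_def B_def)
  have AB: "a < b" if "a \<in> A" "b \<in> B" for a b
    using that ord by (force simp: A_def B_def)
  obtain y where y: "y \<notin> F \<union> set w" "\<And>a. a \<in> A \<Longrightarrow> a < y" "\<And>b. b \<in> B \<Longrightarrow> y < b"
    using finite_separation_real[of A B "F \<union> set w"] fin F AB by auto
  have last: "w ! i < y \<longleftrightarrow> p ! i < p ! (r - 1)" "y < w ! i \<longleftrightarrow> p ! (r - 1) < p ! i"
    if "Suc i < r" for i
  proof -
    have "p ! i \<noteq> p ! (r - 1)" using that lp by (simp add: nth_eq_iff_index_eq)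
    then consider "p ! i < p ! (r - 1)" | "p ! (r - 1) < p ! i" by linarith
    then have "(w ! i < y \<longleftrightarrow> p ! i < p ! (r - 1)) \<and> (y < w ! i \<longleftrightarrow> p ! (r - 1) < p ! i)"
    proof cases
      case 1
      then have "w ! i < y" using that by (intro y) (auto simp: A_def)
      then show ?thesis using 1 by auto
    next
      case 2
      then have "y < w ! i" using that by (intro y) (auto simp: B_def)
      then show ?thesis using 2 by auto
    qed
    then show "w ! i < y \<longleftrightarrow> p ! i < p ! (r - 1)" "y < w ! i \<longleftrightarrow> p ! (r - 1) < p ! i" by auto
  qed
  have "std (w @ [y]) = p"
  proof (rule std_eqI[OF p])
    fix i j assume ij: "i < r" "j < r"
    have c: "Suc k < r \<or> k = r - 1" if "k < r" for k using that by linarith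
    from c[OF ij(1)] c[OF ij(2)]
    show "(w @ [y]) ! i < (w @ [y]) ! j \<longleftrightarrow> p ! i < p ! j"
      using w ord last u(3) by (auto simp: nth_append less_diff_conv)
  qed (use w y u in auto)
  then show thesis using that[of y] y(1) by (simp add: w_def)
qed

lemma realize_walk:
  assumes r: "r > 0" and K: "K \<subseteq> PSG_verts r" "\<not> acyclic (PSG_edges r \<inter> K \<times> K)"
  shows "\<exists>ys::real list. length ys = s \<and> distinct ys \<and> (\<forall>i. i + r \<le> s \<longrightarrow> std (take r (drop i ys)) \<in> K)"
proof -
  from K(2) obtain A where A: "A \<noteq> {}" "A \<subseteq> Field (PSG_edges r \<inter> K \<times> K)"
      "\<And>b. b \<in> A \<Longrightarrow> \<exists>c\<in>A. (b, c) \<in> PSG_edges r \<inter> K \<times> K"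
    by (rule not_acyclic_core) blast
  then have AK: "A \<subseteq> K" by (auto simp: Field_def)
  obtain b where b: "b \<in> A" using A(1) by blast
  have bV: "b \<in> PSG_verts r" using b AK K by blast
  \<comment> \<open>The last window has its pattern in \<open>A\<close>, where a further step is
    always available.\<close>
  have "\<exists>ys::real list. length ys = r + m \<and> distinct ys \<and>
      (\<forall>i\<le>m. std (take r (drop i ys)) \<in> K) \<and> std (drop m ys) \<in> A" for m
  proof (induction m)
    case 0
    have "std (map real b) = b"
    proof (rule std_eqI[OF bV])
      show "distinct (map real b)" using bV by (simp add: PSG_verts_iff distinct_map)
    qed (use PSG_verts_length[OF bV] in auto)
    then show ?case using b AK bV PSG_verts_length[OF bV]
      by (intro exI[of _ "map real b"]) (auto simp: PSG_verts_iff distinct_map)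
  next
    case (Suc m)
    then obtain ys :: "real list" where ys: "length ys = r + m" "distinct ys"
        "\<forall>i\<le>m. std (take r (drop i ys)) \<in> K" "std (drop m ys) \<in> A"
      by blast
    obtain p where p: "p \<in> A" "(std (drop m ys), p) \<in> PSG_edges r" using A(3) ys(4) by blast
    obtain y where y: "y \<notin> set ys" "std (tl (drop m ys) @ [y]) = p"
      by (rule extend_realization[of "drop m ys" r p "set ys"]) (use p ys r in auto)
    have d: "drop (Suc m) (ys @ [y]) = tl (drop m ys) @ [y]"
      using ys r by (simp add: tl_drop drop_Suc)
    have "std (take r (drop i (ys @ [y]))) \<in> K" if "i \<le> Suc m" for i
    proof (cases "i = Suc m")
      case True
      have "take r (drop i (ys @ [y])) = tl (drop m ys) @ [y]"
        unfolding True d using ys r by simp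
      then show ?thesis using y p AK by auto
    next
      case False
      then have "take r (drop i (ys @ [y])) = take r (drop i ys)" using ys that by simp
      then show ?thesis using ys that False by simp
    qed
    then show ?case using ys y p d by (intro exI[of _ "ys @ [y]"]) simp
  qed
  \<comment> \<open>A sequence longer than required is cut down to length \<open>s\<close>, which
    also covers \<open>s < r\<close>.\<close>
  then obtain ys :: "real list" where ys: "length ys = r + s" "distinct ys"
      "\<forall>i\<le>s. std (take r (drop i ys)) \<in> K" by blast
  show ?thesis
  proof (intro exI[of _ "take s ys"] conjI allI impI)
    fix i assume i: "i + r \<le> s"
    then have "take r (drop i (take s ys)) = take r (drop i ys)"
      by (simp add: drop_take min_def)
    then show "std (take r (drop i (take s ys))) \<in> K" using ys i by simp
  qed (use ys in auto)
qed

subsection \<open>Tournaments given by patterns\<close>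

text \<open>With an acyclic \<open>K\<close> these are the tournaments with short tight paths only.
  With any \<open>K\<close> of size k they witness that tournaments exist for all n.\<close>

definition pattern_tournament :: "nat \<Rightarrow> nat \<Rightarrow> nat list set \<Rightarrow> nat hyperdigraph" where
  "pattern_tournament n r K = \<lparr>verts = {..<n},
     edges = {e. distinct e \<and> length e = r \<and> set e \<subseteq> {..<n} \<and> std e \<in> K}\<rparr>"

lemma tournament_pattern_tournament:
  assumes K: "K \<subseteq> PSG_verts r"
  shows "tournament r (card K) (pattern_tournament n r K)"
  unfolding tournament_def
proof (intro conjI allI impI)
  show "card K \<le> fact r" using card_mono[OF _ K] by (simp add: card_PSG_verts)
  show "r_digraph r (pattern_tournament n r K)"
    by (auto simp: r_digraph_def pattern_tournament_def)
  fix S assume S: "S \<subseteq> verts (pattern_tournament n r K) \<and> card S = r"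
  then have fin: "finite S" "S \<subseteq> {..<n}" by (auto simp: pattern_tournament_def finite_subset)
  have eq: "permutations_of_set S \<inter> edges (pattern_tournament n r K)
        = {e \<in> permutations_of_set S. std e \<in> K}"
    using fin S by (auto simp: pattern_tournament_def permutations_of_set_def distinct_card)
  have "card {e \<in> permutations_of_set S. std e \<in> K} = card (std ` {e \<in> permutations_of_set S. std e \<in> K})"
    by (intro card_image[symmetric] inj_on_subset[OF inj_on_std]) auto
  also have "std ` {e \<in> permutations_of_set S. std e \<in> K} = std ` permutations_of_set S \<inter> K" by auto
  also have "\<dots> = K" using K S std_image_permutations_of_set fin by blast
  finally show "card (permutations_of_set S \<inter> edges (pattern_tournament n r K)) = card K"
    using eq by simp
qed

section \<open>The path number as the maximum of a bounded set\<close>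

definition path_lengths :: "nat \<Rightarrow> nat \<Rightarrow> nat \<Rightarrow> nat set" where
  "path_lengths n r k = {s. \<forall>G :: nat hyperdigraph.
     tournament r k G \<and> card (verts G) = n \<longrightarrow> contains_copy G (tight_path r s)}"

text \<open>An actual tournament on n vertices is used here; if there were none, every length would
  qualify vacuously.\<close>

lemma path_lengths_le:
  assumes "k \<le> fact r" "s \<in> path_lengths n r k" shows "s \<le> n"
proof -
  obtain K where K: "K \<subseteq> PSG_verts r" "card K = k"
    using assms(1) by (metis card_PSG_verts obtain_subset_with_card_n)
  have "contains_copy (pattern_tournament n r K) (tight_path r s)"
    using assms(2) tournament_pattern_tournament[OF K(1), of n] K
    by (auto simp: path_lengths_def pattern_tournament_def)
  then obtain g :: "nat \<Rightarrow> nat" where "inj_on g {1..s}" "g ` {1..s} \<subseteq> {..<n}"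
    by (auto simp: contains_copy_def tight_path_def pattern_tournament_def)
  then have "card {1..s} \<le> card {..<n}" by (intro card_inj_on_le) auto
  then show ?thesis by simp
qed

lemma path_number_eq_Max: "path_number n r k = Max (path_lengths n r k)"
  by (simp add: path_number_def path_lengths_def)

lemma finite_path_lengths: "k \<le> fact r \<Longrightarrow> finite (path_lengths n r k)"
  using path_lengths_le by (meson finite_nat_set_iff_bounded_le)

lemma zero_in_path_lengths: "r > 0 \<Longrightarrow> 0 \<in> path_lengths n r k"
  by (auto simp: path_lengths_def contains_copy_def tight_path_def)

lemma path_number_ge:
  "k \<le> fact r \<Longrightarrow> s \<in> path_lengths n r k \<Longrightarrow> s \<le> path_number n r k"
  by (simp add: path_number_eq_Max finite_path_lengths)

lemma path_number_in_path_lengths: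
  "k \<le> fact r \<Longrightarrow> r > 0 \<Longrightarrow> path_number n r k \<in> path_lengths n r k"
  unfolding path_number_eq_Max
  by (rule Max_in) (use finite_path_lengths zero_in_path_lengths in blast)+

text \<open>The patterns of successive windows of a tight path form a walk inside \<open>K\<close>.
  In an acyclic graph a walk repeats no vertex, so there are at most \<open>card K\<close>
  windows.\<close>

lemma path_number_le_acyclic:
  assumes r: "r > 0" and K: "K \<subseteq> PSG_verts r" "acyclic (PSG_edges r \<inter> K \<times> K)"
  shows "path_number n r (card K) \<le> r + card K"
proof (rule ccontr)
  assume less: "\<not> path_number n r (card K) \<le> r + card K"
  define s where "s = path_number n r (card K)"
  have s: "s > r + card K" using less by (simp add: s_def)
  have finK: "finite K" using K finite_subset finite_PSG_verts by blast
  have "card K \<le> fact r" using card_mono[OF _ K(1)] by (simp add: card_PSG_verts)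
  then have "contains_copy (pattern_tournament n r K) (tight_path r s)"
    using path_number_in_path_lengths[of "card K" r n] r tournament_pattern_tournament[OF K(1), of n]
    by (auto simp: path_lengths_def pattern_tournament_def s_def)
  then obtain g where g: "inj_on g {1..s}"
     and gE: "\<forall>e\<in>{[i..<i + r] | i. 1 \<le> i \<and> i + r \<le> s + 1}. map g e \<in> edges (pattern_tournament n r K)"
    unfolding contains_copy_def tight_path_def by auto
  have gK: "std (map g [i..<i + r]) \<in> K" if "1 \<le> i" "i + r \<le> s + 1" for i
    using gE that by (fastforce simp: pattern_tournament_def)
  \<comment> \<open>The vertices of a tight path are numbered from 1, hence \<open>Suc i\<close>.
    The indices 0 to \<open>card K\<close> give one window more than \<open>K\<close> has
    elements.\<close>
  define p where "p i = std (map g [Suc i..<Suc i + r])" for i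
  have pK: "p i \<in> K" if "i \<le> card K" for i
    using gK[of "Suc i"] s that by (simp add: p_def)
  have edge: "(p i, p (Suc i)) \<in> PSG_edges r \<inter> K \<times> K" if "Suc i \<le> card K" for i
  proof -
    let ?zs = "map g [Suc i..<Suc (Suc i + r)]"
    have "distinct ?zs"
      unfolding distinct_map using s that
      by (intro conjI distinct_upt inj_on_subset[OF g]) auto
    then have "(std (take r ?zs), std (drop 1 ?zs)) \<in> PSG_edges r"
      by (intro std_consecutive_PSG_edges) auto
    moreover have "take r ?zs = map g [Suc i..<Suc i + r]" by (simp add: take_map take_upt)
    moreover have "drop 1 ?zs = map g [Suc (Suc i)..<Suc (Suc i) + r]" by (simp add: drop_map del: upt_Suc)
    ultimately show ?thesis using pK[of i] pK[of "Suc i"] that by (simp add: p_def)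
  qed
  have path: "(p i, p j) \<in> (PSG_edges r \<inter> K \<times> K)\<^sup>+" if "i < j" "j \<le> card K" for i j
    using that
  proof (induction j)
    case (Suc j)
    then show ?case using edge[of j] by (cases "i = j") (auto intro: trancl_into_trancl)
  qed simp
  have "\<not> inj_on p {..card K}"
  proof
    assume "inj_on p {..card K}"
    then have "card {..card K} \<le> card K" using pK finK by (intro card_inj_on_le) auto
    then show False by simp
  qed
  then obtain i j where "i \<le> card K" "j \<le> card K" "i \<noteq> j" "p i = p j" by (auto simp: inj_on_def)
  then have "\<exists>x. (x, x) \<in> (PSG_edges r \<inter> K \<times> K)\<^sup>+"
    using path[of i j] path[of j i] by (metis linorder_neqE_nat)
  then show False using K(2) by (auto simp: acyclic_def)
qed

text \<open>Colour each r-set of vertices by the set of patterns of its edges, encoded as a number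
  below 2^(r!). On a homogeneous set all colours are one set \<open>K\<close> of k patterns, too
  large to be acyclic, and \<open>realize_walk\<close> supplies the path.\<close>

lemma path_lengths_eventually:
  assumes r: "r > 0" and k: "max_acyclic (PSG_verts r) (PSG_edges r) < k" 
  obtains N where "\<And>n. n \<ge> N \<Longrightarrow> s \<in> path_lengths n r k"
proof -
  define c :: nat where "c = 2 ^ fact r"
  obtain code :: "nat list set \<Rightarrow> nat" where code: "bij_betw code (Pow (PSG_verts r)) {..<c}"
    using ex_bij_betw_finite_nat[of "Pow (PSG_verts r)"]
    by (auto simp: card_Pow card_PSG_verts c_def lessThan_atLeast0)
  obtain N :: nat where N: "partn_lst {..<N} (replicate c s) r" using ramsey_full by blast
  show thesis
  proof (rule that)
    fix n assume n: "N \<le> n"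
    show "s \<in> path_lengths n r k"
      unfolding path_lengths_def
    proof (intro CollectI allI impI, elim conjE)
      fix G :: "nat hyperdigraph" assume G: "tournament r k G" "card (verts G) = n"
      have finG: "finite (verts G)" using G by (auto simp: tournament_def r_digraph_def)
      obtain h where h: "inj_on h {..<N}" "h ` {..<N} \<subseteq> verts G"
        using card_le_inj[of "{..<N}" "verts G"] finG G n by auto
      define P where "P S = std ` (permutations_of_set S \<inter> edges G)" for S
      have Psub: "P S \<in> Pow (PSG_verts r)" if "finite S" "card S = r" for S
        using std_image_permutations_of_set[OF that] by (auto simp: P_def)
      have hX: "finite (h ` X)" "card (h ` X) = r" if "X \<in> nsets {..<N} r" for X
        using that h by (auto simp: nsets_def card_image inj_on_subset)
      have "(\<lambda>X. code (P (h ` X))) \<in> nsets {..<N} r \<rightarrow> {..<length (replicate c s)}"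
        using code Psub hX by (auto simp: bij_betw_def Pi_def)
      then obtain i H where H: "i < c" "H \<in> nsets {..<N} s"
          "(\<lambda>X. code (P (h ` X))) ` nsets H r \<subseteq> {i}"
        using N by (fastforce simp: partn_lst_def monochromatic_def)
      have HN: "H \<subseteq> {..<N}" "finite H" "card H = s" using H by (auto simp: nsets_def)
      define T where "T = h ` H"
      have T: "finite T" "card T = s" "T \<subseteq> verts G"
        using HN h by (auto simp: T_def card_image inj_on_subset)
      have hom: "code (P S) = i" if S: "S \<subseteq> T" "card S = r" for S
      proof -
        obtain X where X: "X \<subseteq> H" "S = h ` X" using S by (auto simp: T_def subset_image_iff)
        have "inj_on h X" using X HN h inj_on_subset by blast
        then have "X \<in> nsets H r" using X S HN by (auto simp: nsets_def card_image finite_subset)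
        then show ?thesis using H X by auto
      qed
      show "contains_copy G (tight_path r s)"
      proof (cases "r \<le> s")
        case False
        obtain g where "bij_betw g {1..s} T"
          using T finite_same_card_bij[of "{1..s}" T] by auto
        then show ?thesis using False T
          by (auto simp: contains_copy_def tight_path_def bij_betw_def intro!: exI[of _ g])
      next
        case True
        then obtain S0 where S0: "S0 \<subseteq> T" "card S0 = r" using T by (metis obtain_subset_with_card_n)
        define K where "K = P S0"
        have PK: "P S = K" if "S \<subseteq> T" "card S = r" for S
        proof -
          have "code (P S) = code K" using hom that S0 by (simp add: K_def)
          moreover have "P S \<in> Pow (PSG_verts r)" "K \<in> Pow (PSG_verts r)"
            using Psub[of S] Psub[of S0] that S0 finite_subset[OF _ T(1)] by (auto simp: K_def)
          ultimately show ?thesis using inj_onD[OF bij_betw_imp_inj_on[OF code]] by blast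
        qed
        have K: "K \<subseteq> PSG_verts r" using Psub S0 T finite_subset unfolding K_def by blast
        have "card K = card (permutations_of_set S0 \<inter> edges G)"
          unfolding K_def P_def by (intro card_image inj_on_subset[OF inj_on_std]) auto
        also have "\<dots> = k" using G S0 T by (auto simp: tournament_def)
        finally have "\<not> acyclic (PSG_edges r \<inter> K \<times> K)"
          using max_acyclic_ge[of "PSG_verts r" K] K k by force
        from realize_walk[OF r K this, of s] obtain ys :: "real list"
          where ys: "length ys = s" "distinct ys" "\<And>i. i + r \<le> s \<Longrightarrow> std (take r (drop i ys)) \<in> K"
          by blast
        \<comment> \<open>The real sequence is transported to the homogeneous set \<open>T\<close>
          by ordering \<open>T\<close> in the same pattern.\<close>
        have "std ys \<in> PSG_verts s" using std_in_PSG_verts[OF ys(2)] ys by simp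
        then obtain e where e: "e \<in> permutations_of_set T" "std e = std ys"
          using std_image_permutations_of_set[OF T(1,2)] by (metis imageE)
        have es: "length e = s" "distinct e" "set e = T"
          using e T by (auto simp: permutations_of_set_def distinct_card)
        have ord: "e ! i < e ! j \<longleftrightarrow> ys ! i < ys ! j" if "i < s" "j < s" for i j
          using that std_less_iff[of i e j] std_less_iff[of i ys j] e es ys by simp
        have edge: "take r (drop i e) \<in> edges G" if i: "i + r \<le> s" for i
        proof -
          let ?w = "take r (drop i e)"
          have w: "distinct ?w" "length ?w = r" "set ?w \<subseteq> T"
            using es i set_take_subset[of r "drop i e"] set_drop_subset[of i e] by auto
          have "std ?w = std (take r (drop i ys))"
            using i es ys ord by (intro std_cong) auto
          then have "std ?w \<in> P (set ?w)"
            using PK[of "set ?w"] w ys(3)[OF i] by (simp add: distinct_card)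
          \<comment> \<open>Some ordering of these vertices with the pattern of \<open>?w\<close> is
            an edge; by \<open>inj_on_std\<close> it is \<open>?w\<close> itself.\<close>
          then obtain e' where e': "e' \<in> permutations_of_set (set ?w)" "e' \<in> edges G" "std e' = std ?w"
            by (auto simp: P_def)
          moreover have "?w \<in> permutations_of_set (set ?w)" using w by (simp add: permutations_of_set_def)
          ultimately show ?thesis using inj_on_std by (metis inj_onD)
        qed
        show ?thesis unfolding contains_copy_def
        proof (intro exI[of _ "\<lambda>i. e ! (i - 1)"] conjI ballI)
          show "inj_on (\<lambda>i. e ! (i - 1)) (verts (tight_path r s))"
            using es by (auto simp: inj_on_def tight_path_def nth_eq_iff_index_eq)
          show "(\<lambda>i. e ! (i - 1)) ` verts (tight_path r s) \<subseteq> verts G"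
          proof safe
            fix i assume "i \<in> verts (tight_path r s)"
            then have "e ! (i - 1) \<in> set e" using es by (intro nth_mem) (auto simp: tight_path_def)
            then show "e ! (i - 1) \<in> verts G" using es T by auto
          qed
          fix E assume "E \<in> edges (tight_path r s)"
          then obtain i where i: "1 \<le> i" "i + r \<le> s + 1" "E = [i..<i + r]" by (auto simp: tight_path_def)
          have "map (\<lambda>i. e ! (i - 1)) E = take r (drop (i - 1) e)"
            using i es by (intro nth_equalityI) auto
          then show "map (\<lambda>i. e ! (i - 1)) E \<in> edges G" using edge[of "i - 1"] i by simp
        qed
      qed
    qed
  qed
qed

lemma growing_threshold_eq:
  assumes r: "r > 0" and lt: "max_acyclic (PSG_verts r) (PSG_edges r) < fact r"
  shows "growing_threshold r = max_acyclic (PSG_verts r) (PSG_edges r) + 1"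
  unfolding growing_threshold_def
proof (rule Least_equality)
  let ?a = "max_acyclic (PSG_verts r) (PSG_edges r)"
  have "filterlim (\<lambda>n. path_number n r (?a + 1)) at_top sequentially"
    unfolding filterlim_at_top
  proof
    fix s
    obtain N where "\<And>n. n \<ge> N \<Longrightarrow> s \<in> path_lengths n r (?a + 1)"
      using path_lengths_eventually[OF r, of "?a + 1" s] by auto
    then show "\<forall>\<^sub>F n in sequentially. s \<le> path_number n r (?a + 1)"
      unfolding eventually_sequentially using path_number_ge[of "?a + 1" r s] lt
      by (intro exI[of _ N]) auto
  qed
  then show "?a + 1 \<le> fact r \<and> filterlim (\<lambda>n. path_number n r (?a + 1)) at_top sequentially"
    using lt by simp
  fix k assume k: "k \<le> fact r \<and> filterlim (\<lambda>n. path_number n r k) at_top sequentially"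
  show "?a + 1 \<le> k"
  proof (rule ccontr)
    assume "\<not> ?a + 1 \<le> k"
    then have ka: "k \<le> ?a" by simp
    obtain S where S: "S \<subseteq> PSG_verts r" "acyclic (PSG_edges r \<inter> S \<times> S)" "card S = ?a"
      by (rule max_acyclic_witness[OF finite_PSG_verts])
    \<comment> \<open>Subsets of acyclic sets are acyclic, so every k up to the maximum is the size
      of an acyclic set.\<close>
    obtain K where K: "K \<subseteq> S" "card K = k" using ka S by (metis obtain_subset_with_card_n)
    have "acyclic (PSG_edges r \<inter> K \<times> K)" using K by (intro acyclic_subset[OF S(2)]) auto
    then have "path_number n r k \<le> r + k" for n
      using path_number_le_acyclic[OF r, of K n] K S by auto
    moreover have "\<forall>\<^sub>F n in sequentially. r + k + 1 \<le> path_number n r k"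
      using k by (simp add: filterlim_at_top)
    ultimately show False by (metis (no_types, lifting) add_le_same_cancel1 eventually_sequentially le_trans not_one_le_zero order_refl)
  qed
qed

section \<open>The upper bound\<close>

text \<open>This and the next lemma replace probability. Here one of few injective moves leads from
  each element of \<open>X\<close> into \<open>A\<close>, so \<open>A\<close> is not much smaller
  than \<open>X\<close>; next, many moves with disjoint images show that \<open>X\<close> is
  small.\<close>

lemma card_le_if_covered:
  assumes "finite I" "finite A" "\<And>i. i \<in> I \<Longrightarrow> inj_on (f i) X"
    "\<And>x. x \<in> X \<Longrightarrow> \<exists>i\<in>I. f i x \<in> A"
  shows "card X \<le> card I * card A"
proof -
  have inj: "inj_on (f i) {x \<in> X. f i x \<in> A}" if "i \<in> I" for i
    using assms(3)[OF that] by (rule inj_on_subset) auto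
  have im: "f i ` {x \<in> X. f i x \<in> A} \<subseteq> A" for i by auto
  have fin: "finite {x \<in> X. f i x \<in> A}" if "i \<in> I" for i
    using inj[OF that] im assms(2) by (meson finite_imageD finite_subset)
  have "X \<subseteq> (\<Union>i\<in>I. {x \<in> X. f i x \<in> A})" using assms(4) by auto
  then have "card X \<le> card (\<Union>i\<in>I. {x \<in> X. f i x \<in> A})"
    using assms(1) fin by (intro card_mono) auto
  also have "\<dots> \<le> (\<Sum>i\<in>I. card {x \<in> X. f i x \<in> A})" by (rule card_UN_le[OF assms(1)])
  also have "\<dots> \<le> (\<Sum>i\<in>I. card A)" by (intro sum_mono card_inj_on_le[OF inj im assms(2)])
  finally show ?thesis by simp
qed

lemma card_le_if_disjoint_images:
  assumes "finite V" "\<And>i x. i \<in> I \<Longrightarrow> x \<in> X \<Longrightarrow> f i x \<in> V" "\<And>i. i \<in> I \<Longrightarrow> inj_on (f i) X"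
    "\<And>i j x y. i \<in> I \<Longrightarrow> j \<in> I \<Longrightarrow> x \<in> X \<Longrightarrow> y \<in> X \<Longrightarrow> f i x = f j y \<Longrightarrow> i = j"
  shows "card I * card X \<le> card V"
proof -
  have "inj_on (\<lambda>(i, x). f i x) (I \<times> X)"
    using assms(3,4) by (fastforce simp: inj_on_def)
  moreover have "(\<lambda>(i, x). f i x) ` (I \<times> X) \<subseteq> V" using assms(2) by auto
  ultimately have "card (I \<times> X) \<le> card V" using assms(1) by (rule card_inj_on_le)
  then show ?thesis by (simp add: card_cartesian_product)
qed

section \<open>Rotation classes as cycles\<close>

lemma not_acyclic_if_closed_walk:
  assumes "a \<le> b" "\<And>j. a \<le> j \<Longrightarrow> j \<le> b \<Longrightarrow> q j \<in> S"
    "\<And>j. a \<le> j \<Longrightarrow> j < b \<Longrightarrow> (q j, q (Suc j)) \<in> E" "(q b, q a) \<in> E"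
  shows "\<not> acyclic (E \<inter> S \<times> S)"
proof -
  have "(q a, q j) \<in> (E \<inter> S \<times> S)\<^sup>*" if "a \<le> j" "j \<le> b" for j
    using that
  proof (induction j rule: dec_induct)
    case (step j)
    then have "(q j, q (Suc j)) \<in> E \<inter> S \<times> S" using assms(2)[of j] assms(2)[of "Suc j"] assms(3)[of j] by auto
    then show ?case using step by (meson Suc_leD rtrancl.rtrancl_into_rtrancl)
  qed simp
  moreover have "(q b, q a) \<in> E \<inter> S \<times> S" using assms by auto
  ultimately have "(q a, q a) \<in> (E \<inter> S \<times> S)\<^sup>+" using assms(1)
    by (meson order_refl rtrancl_into_trancl1)
  then show ?thesis by (auto simp: acyclic_def)
qed

lemma rotate_PSG_verts [simp]: "rotate k xs \<in> PSG_verts r \<longleftrightarrow> xs \<in> PSG_verts r"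
  by (simp add: PSG_verts_iff)

lemma inj_rotate: "inj (rotate k)"
proof (rule injI)
  fix xs ys :: "'a list" assume eq: "rotate k xs = rotate k ys"
  then have l: "length xs = length ys" by (metis length_rotate)
  show "xs = ys"
  proof (cases "xs = []")
    case False
    have "rotate (k * (length xs - 1)) (rotate k zs) = zs" if "length zs = length xs" for zs :: "'a list"
    proof -
      have "k * (length xs - 1) + k = k * length zs"
        using False that by (cases xs) auto
      then have "rotate (k * (length xs - 1)) (rotate k zs) = rotate (k * length zs) zs"
        by (simp add: rotate_rotate)
      also have "\<dots> = zs" by (subst rotate_conv_mod) simp
      finally show ?thesis .
    qed
    then show ?thesis using eq l by metis
  qed (use l in auto)
qed

lemma rotate1_edge: "xs \<in> PSG_verts r \<Longrightarrow> (xs, rotate1 xs) \<in> PSG_edges r"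
  using rotate_PSG_verts[of 1 xs r]
  by (auto simp: PSG_edges_iff nth_rotate1 PSG_verts_length)

lemma rotation_class_cycle:
  assumes "r > 0" "xs \<in> PSG_verts r" "acyclic (PSG_edges r \<inter> S \<times> S)"
  shows "\<exists>k<r. rotate k xs \<notin> S"
proof (rule ccontr)
  assume "\<not> ?thesis"
  then have S: "rotate k xs \<in> S" if "k < r" for k using that by blast
  have e: "(rotate k xs, rotate (Suc k) xs) \<in> PSG_edges r" for k
    using rotate1_edge[of "rotate k xs" r] assms(2) by simp
  have "rotate r xs = xs" using PSG_verts_length[OF assms(2)] rotate_conv_mod[of r xs] by simp
  then have "(rotate (r - 1) xs, rotate 0 xs) \<in> PSG_edges r" using e[of "r - 1"] assms(1) by simp
  then have "\<not> acyclic (PSG_edges r \<inter> S \<times> S)"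
    using S e assms(1) by (intro not_acyclic_if_closed_walk[of 0 "r - 1" "\<lambda>k. rotate k xs"]) auto
  then show False using assms(3) by contradiction
qed

subsection \<open>Arithmetic progressions modulo $r$\<close>

definition progression :: "nat \<Rightarrow> nat \<Rightarrow> nat \<Rightarrow> nat list" where
  "progression r d c = map (\<lambda>i. (c + d * i) mod r + 1) [0..<r]"

lemma progression_mod: "progression r d (c mod r) = progression r d c"
  by (simp add: progression_def mod_add_left_eq)

lemma coprime_mult_inj:
  assumes "coprime d r" "(c + d * i) mod r = (c + d * j) mod r" "i < r" "j < (r::nat)"
  shows "i = j"
proof -
  have "[c + d * i = c + d * j] (mod r)" using assms(2) by (simp add: unique_euclidean_semiring_class.cong_def)
  then have "[d * i = d * j] (mod r)" by (simp add: cong_add_lcancel_nat)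
  then have "[i = j] (mod r)" using assms(1) by (simp add: cong_mult_lcancel_nat)
  then show ?thesis using assms by (simp add: cong_less_modulus_unique_nat)
qed

lemma progression_PSG_verts:
  assumes "coprime d r" "r > 0" shows "progression r d c \<in> PSG_verts r"
proof -
  have "inj_on (\<lambda>i. (c + d * i) mod r + 1) {..<r}"
  proof (rule inj_onI)
    fix i j assume "i \<in> {..<r}" "j \<in> {..<r}" "(c + d * i) mod r + 1 = (c + d * j) mod r + 1"
    then show "i = j" using coprime_mult_inj[OF assms(1), of c i j] by simp
  qed
  then have d: "distinct (progression r d c)"
    by (simp add: progression_def distinct_map lessThan_atLeast0)
  have "set (progression r d c) \<subseteq> {1..r}"
    using assms(2) by (auto simp: progression_def Suc_le_eq)
  moreover have "card (set (progression r d c)) = r"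
    using distinct_card[OF d] by (simp add: progression_def)
  ultimately have "set (progression r d c) = {1..r}" by (intro card_subset_eq) auto
  with d show ?thesis by (simp add: PSG_verts_iff)
qed

lemma rotate1_progression: "rotate1 (progression r d c) = progression r d (c + d)"
proof (rule nth_equalityI)
  fix i assume "i < length (rotate1 (progression r d c))"
  then have i: "i < r" by (simp add: progression_def)
  have "(c + d * (Suc i mod r)) mod r = (c + d * Suc i) mod r"
    by (metis mod_add_right_eq mod_mult_right_eq)
  then show "rotate1 (progression r d c) ! i = progression r d (c + d) ! i"
    using i by (simp add: progression_def nth_rotate1 ac_simps)
qed (simp add: progression_def)

text \<open>Translation by one preserves the order of all residues except the largest one, and that one
  is exactly the entry which an edge of the pattern-shift graph forgets.\<close>

lemma progression_extra_edges:
  assumes "coprime d r" "r > 0"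
  shows "(progression r d (r - 1), progression r d d) \<in> PSG_edges r"
    and "(progression r d 0, progression r d (d + (r - 1))) \<in> PSG_edges r"
proof -
  \<comment> \<open>By coprimality the residue 0 is not among the \<open>y i\<close>, hence
    subtracting 1 does not wrap around. The forgotten first entry is the value r for the first edge
    and 1 for the second.\<close>
  define y where "y i = d * Suc i mod r" for i
  have y: "0 < y i" "y i < r" if "Suc i < r" for i
  proof -
    have "\<not> r dvd d * Suc i"
      using assms that by (metis coprime_commute coprime_dvd_mult_right_iff nat_dvd_not_less zero_less_Suc)
    then show "0 < y i" by (simp add: y_def mod_greater_zero_iff_not_dvd)
  qed (use assms in \<open>simp add: y_def\<close>)
  have sh: "(d * Suc i + (r - 1)) mod r = y i - 1" if "Suc i < r" for i
  proof -
    have "(d * Suc i + (r - 1)) mod r = (y i + (r - 1)) mod r" by (simp add: y_def mod_add_left_eq)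
    also have "y i + (r - 1) = (y i - 1) + r" using y[OF that] by simp
    also have "(y i - 1 + r) mod r = y i - 1" using y[OF that]
      by (metis less_imp_diff_less mod_add_self2 mod_less)
    finally show ?thesis .
  qed
  have n1: "progression r d (r - 1) ! Suc i = y i" "progression r d d ! i = y i + 1"
     "progression r d 0 ! Suc i = y i + 1" "progression r d (d + (r - 1)) ! i = y i"
    if "Suc i < r" for i
  proof -
    have e: "d + d * i = d * Suc i" "r - 1 + d * Suc i = d * Suc i + (r - 1)"
      "d + (r - 1) + d * i = d * Suc i + (r - 1)" by simp_all
    show "progression r d (r - 1) ! Suc i = y i" "progression r d d ! i = y i + 1"
     "progression r d 0 ! Suc i = y i + 1" "progression r d (d + (r - 1)) ! i = y i"
      using that y[OF that] sh[OF that] unfolding progression_def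
      by (simp_all only: nth_map_upt diff_zero add_0 e y_def Suc_lessD[OF that] length_upt nth_map nth_upt)
  qed
  show "(progression r d (r - 1), progression r d d) \<in> PSG_edges r"
    and "(progression r d 0, progression r d (d + (r - 1))) \<in> PSG_edges r"
    using n1 progression_PSG_verts[OF assms] by (auto simp: PSG_edges_iff)
qed

definition progression_class :: "nat \<Rightarrow> nat \<Rightarrow> nat list set" where
  "progression_class r d = range (progression r d)"

text \<open>Writing the offset as \<open>d * j\<close> turns rotation into the step from j to j + 1,
  so the two extra edges become chords of a cycle of length r.\<close>

lemma progression_class_eq:
  assumes "coprime d r" "r > 0"
  shows "progression_class r d = (\<lambda>j. progression r d (d * j)) ` {1..r}"
    and "inj_on (\<lambda>j. progression r d (d * j)) {1..r}"
proof -
  show inj: "inj_on (\<lambda>j. progression r d (d * j)) {1..r}"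
  proof (rule inj_onI)
    fix i j assume ij: "i \<in> {1..r}" "j \<in> {1..r}" "progression r d (d * i) = progression r d (d * j)"
    then have "progression r d (d * i) ! 0 = progression r d (d * j) ! 0" by simp
    then have "(d * i) mod r = (d * j) mod r" using assms(2) by (simp add: progression_def)
    then have "(d + d * (i - 1)) mod r = (d + d * (j - 1)) mod r" using ij
      by (simp add: algebra_simps)
    then have "i - 1 = j - 1"
      by (rule coprime_mult_inj[OF assms(1)]) (use ij in auto)
    then show "i = j" using ij(1,2) by simp arith
  qed
  have sub: "(\<lambda>j. progression r d (d * j)) ` {1..r} \<subseteq> progression_class r d"
    by (auto simp: progression_class_def)
  have cl: "progression_class r d = progression r d ` {..<r}"
  proof -
    have "progression r d c \<in> progression r d ` {..<r}" for c
      using assms(2) progression_mod[of r d c] by (metis imageI lessThan_iff mod_less_divisor)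
    then show ?thesis by (auto simp: progression_class_def)
  qed
  have "card (progression_class r d) \<le> r" unfolding cl using card_image_le[of "{..<r}" "progression r d"] by simp
  moreover have "card ((\<lambda>j. progression r d (d * j)) ` {1..r}) = r" using inj by (simp add: card_image)
  moreover have "finite (progression_class r d)" by (simp add: cl)
  ultimately show "progression_class r d = (\<lambda>j. progression r d (d * j)) ` {1..r}"
    using sub by (metis card_seteq)
qed

text \<open>Let m be the index of the progression with offset r - 1. One chord leads from m back to
  1, the other from r back to m + 1, so the class splits into two disjoint cycles, and each of them
  loses a vertex.\<close>

lemma progression_class_two_cycles:
  assumes d: "coprime d r" "r > 1" and S: "acyclic (PSG_edges r \<inter> S \<times> S)"
  shows "2 \<le> card (progression_class r d - S)"
proof -
  let ?q = "\<lambda>j. progression r d (d * j)"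
  have r0: "r > 0" using d by simp
  have fin: "finite (progression_class r d)" using progression_class_eq[OF d(1) r0] by simp
  have "progression r d (r - 1) \<in> ?q ` {1..r}"
    using progression_class_eq(1)[OF d(1) r0] by (auto simp: progression_class_def)
  then obtain m where m: "1 \<le> m" "m \<le> r" "?q m = progression r d (r - 1)" by auto
  have qr: "?q r = progression r d 0" using progression_mod[of r d "d * r"] by simp
  have "m \<noteq> r"
  proof
    assume "m = r"
    then have "progression r d (r - 1) ! 0 = progression r d 0 ! 0" using m qr by simp
    then show False using d by (simp add: progression_def)
  qed
  then have mr: "m < r" using m by simp
  have step: "(?q j, ?q (Suc j)) \<in> PSG_edges r" for j
    using rotate1_edge[OF progression_PSG_verts[OF d(1) r0, of "d * j"]]
    by (simp add: rotate1_progression add.commute)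
  have c1: "(?q m, ?q 1) \<in> PSG_edges r" using progression_extra_edges(1)[OF d(1) r0] m by simp
  have "?q (Suc m) = rotate1 (?q m)" by (simp add: rotate1_progression add.commute)
  also have "\<dots> = progression r d (d + (r - 1))" using m by (simp add: rotate1_progression add.commute)
  finally have c2: "(?q r, ?q (Suc m)) \<in> PSG_edges r"
    using progression_extra_edges(2)[OF d(1) r0] qr by simp
  obtain i where i: "1 \<le> i" "i \<le> m" "?q i \<notin> S"
    using not_acyclic_if_closed_walk[of 1 m ?q S "PSG_edges r"] c1 step m S by blast
  obtain j where j: "Suc m \<le> j" "j \<le> r" "?q j \<notin> S"
    using not_acyclic_if_closed_walk[of "Suc m" r ?q S "PSG_edges r"] c2 step mr S by (metis Suc_leI)
  have "?q i \<noteq> ?q j" using i j inj_onD[OF progression_class_eq(2)[OF d(1) r0], of i j] by auto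
  moreover have "{?q i, ?q j} \<subseteq> progression_class r d - S"
    using i j by (auto simp: progression_class_def)
  ultimately show ?thesis using card_mono[of "progression_class r d - S" "{?q i, ?q j}"] fin by simp
qed

lemma progression_class_disjoint:
  assumes "d < r" "d' < r" "r > 1" "d \<noteq> d'"
  shows "progression_class r d \<inter> progression_class r d' = {}"
proof (rule ccontr)
  assume "\<not> ?thesis"
  then obtain c c' where eq: "progression r d c = progression r d' c'"
    by (auto simp: progression_class_def)
  then have "progression r d c ! 0 = progression r d' c' ! 0" "progression r d c ! 1 = progression r d' c' ! 1"
    by auto
  then have "[c = c'] (mod r)" "[c + d = c' + d'] (mod r)"
    using assms(3) by (auto simp: progression_def unique_euclidean_semiring_class.cong_def)
  then have "[c + d = c + d'] (mod r)" by (meson cong_add_rcancel_nat cong_sym cong_trans)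
  then have "[d = d'] (mod r)" by (simp add: cong_add_lcancel_nat)
  then show False using assms by (simp add: cong_less_modulus_unique_nat)
qed

text \<open>The totient(r) progression classes lose at least 2 vertices each. Of the remaining r! -
  r * totient(r) permutations at least one in r is lost. In total this is r!/r + totient(r); the
  statement is multiplied by r to stay in the naturals.\<close>

lemma acyclic_card_upper:
  assumes r: "r > 1" and S: "S \<subseteq> PSG_verts r" "acyclic (PSG_edges r \<inter> S \<times> S)"
  shows "r * card S + fact r + r * totient r \<le> r * fact r"
proof -
  define F where "F = PSG_verts r - S"
  define W where "W = (\<Union>d\<in>totatives r. progression_class r d)"
  define U where "U = PSG_verts r - W"
  have r0: "r > 0" using r by simp
  have tot: "coprime d r" "d < r" if "d \<in> totatives r" for d
    using that r totatives_less[of d r] by (auto simp: totatives_def)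
  have clV: "progression_class r d \<subseteq> PSG_verts r" if "d \<in> totatives r" for d
    using progression_PSG_verts[OF tot(1)[OF that] r0] by (auto simp: progression_class_def)
  have disj: "\<And>d d'. d \<in> totatives r \<Longrightarrow> d' \<in> totatives r \<Longrightarrow> d \<noteq> d' \<Longrightarrow>
      progression_class r d \<inter> progression_class r d' = {}"
    using progression_class_disjoint tot r by blast
  have fincl: "finite (progression_class r d)" if "d \<in> totatives r" for d
    using clV[OF that] finite_subset finite_PSG_verts by blast
  have cardW: "card W = r * totient r"
  proof -
    have "card W = (\<Sum>d\<in>totatives r. card (progression_class r d))"
      unfolding W_def using fincl disj by (intro card_UN_disjoint) auto
    also have "\<dots> = (\<Sum>d\<in>totatives r. r)"
      using progression_class_eq[OF tot(1) r0] by (intro sum.cong) (auto simp: card_image)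
    finally show ?thesis by (simp add: totient_def)
  qed
  have WV: "W \<subseteq> PSG_verts r" using clV by (auto simp: W_def)
  have cardU: "card U + r * totient r = fact r"
    unfolding U_def using cardW WV card_mono[OF _ WV]
    by (simp add: card_Diff_subset finite_subset card_PSG_verts)
  \<comment> \<open>Rotating r - 1 more times returns to \<open>xs\<close> without leaving the
    class. So the complement \<open>U\<close> is closed under rotation and the covering argument
    applies inside it.\<close>
  have rotW: "xs \<in> W" if xs: "rotate1 xs \<in> W" "xs \<in> PSG_verts r" for xs
  proof -
    obtain d c where d: "d \<in> totatives r" "rotate1 xs = progression r d c"
      using xs(1) by (auto simp: W_def progression_class_def)
    have "rotate r xs = xs" using PSG_verts_length[OF xs(2)] rotate_conv_mod[of r xs] by simp
    have "rotate k (rotate1 xs) = progression r d (c + k * d)" for k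
      by (induction k) (auto simp: d rotate1_progression ac_simps)
    from this[of "r - 1"] have "rotate r xs \<in> progression_class r d"
      using r0 by (metis Suc_diff_1 progression_class_def rangeI rotate_Suc rotate1_rotate_swap)
    then show ?thesis using \<open>rotate r xs = xs\<close> d by (auto simp: W_def)
  qed
  have rotU: "rotate k xs \<in> U" if "xs \<in> U" for k xs
  proof (induction k)
    case (Suc k)
    then show ?case using rotW[of "rotate k xs"] rotate_PSG_verts[of "Suc k" xs r] that
      by (auto simp: U_def)
  qed (use that in simp)
  have "card U \<le> card {..<r} * card (F \<inter> U)"
  proof (rule card_le_if_covered[where f = rotate])
    show "\<exists>k\<in>{..<r}. rotate k xs \<in> F \<inter> U" if "xs \<in> U" for xs
      using rotation_class_cycle[OF r0 _ S(2), of xs] rotU[OF that] that by (force simp: F_def U_def)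
  qed (auto simp: F_def intro: inj_on_subset[OF inj_rotate])
  then have FU: "card U \<le> r * card (F \<inter> U)" by simp
  have FW: "2 * totient r \<le> card (F \<inter> W)"
  proof -
    have "F \<inter> W = (\<Union>d\<in>totatives r. progression_class r d - S)" using clV by (auto simp: F_def W_def)
    moreover have "card \<dots> = (\<Sum>d\<in>totatives r. card (progression_class r d - S))"
      using fincl disj by (intro card_UN_disjoint) auto
    moreover have "(\<Sum>d\<in>totatives r. 2) \<le> (\<Sum>d\<in>totatives r. card (progression_class r d - S))"
      using progression_class_two_cycles[OF tot(1) r S(2)] by (intro sum_mono) auto
    ultimately show ?thesis by (simp add: totient_def)
  qed
  have FUW: "F = (F \<inter> U) \<union> (F \<inter> W)" by (auto simp: F_def U_def)
  have "card F = card (F \<inter> U) + card (F \<inter> W)"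
    by (subst (1) FUW, subst card_Un_disjoint) (auto simp: F_def U_def)
  then have "r * card F \<ge> r * card (F \<inter> U) + r * (2 * totient r)"
    using FW by (simp add: distrib_left)
  then have "r * card F \<ge> fact r + r * totient r" using FU cardU by simp
  moreover have "card S + card F = fact r"
    unfolding F_def using S(1) card_mono[OF _ S(1)]
    by (simp add: card_Diff_subset finite_subset card_PSG_verts)
  then have "r * card S + r * card F = r * fact r" by (metis distrib_left)
  ultimately show ?thesis by linarith
qed

section \<open>The lower bound\<close>

text \<open>With offsets inside the window: entry \<open>0\<close> is the largest, entry \<open>1\<close> the second, entry \<open>L - 2\<close> the third
  largest, and entry \<open>L - 1\<close> the smallest. Comparing entry \<open>L - 2\<close> of the left window with the first entries of
  the right one excludes all overlaps in more than two positions. An overlap in one or two positions forces one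
  entry to be small on its left and large on its right, which has probability exponentially small in \<open>L\<close>.\<close>

definition marked :: "nat \<Rightarrow> (nat \<Rightarrow> nat) \<Rightarrow> nat \<Rightarrow> bool" where
  "marked L e i \<longleftrightarrow>
     (\<forall>k. 1 \<le> k \<and> k < L \<longrightarrow> e (i + k) < e i) \<and>
     (\<forall>k. 2 \<le> k \<and> k < L \<longrightarrow> e (i + k) < e (i + 1)) \<and>
     (\<forall>k. 2 \<le> k \<and> k < L - 2 \<longrightarrow> e (i + k) < e (i + (L - 2))) \<and>
     (\<forall>k < L - 1. e (i + (L - 1)) < e (i + k))"

text \<open>The signs of \<open>n\<close> disjoint pairs of entries of the window, none of which is one of the four
  extremal entries.\<close>

definition key :: "nat \<Rightarrow> (nat \<Rightarrow> nat) \<Rightarrow> nat \<Rightarrow> nat" where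
  "key n e i = set_encode {k. k < n \<and> e (i + (2 + 2 * k)) < e (i + (3 + 2 * k))}"

text \<open>\<open>Suc\<close> gives every marked window a positive score, so one mark anywhere
  forces a window of maximal score to be marked.\<close>

definition score :: "nat \<Rightarrow> (nat \<Rightarrow> nat) \<Rightarrow> nat \<Rightarrow> nat" where
  "score n e i = (if marked (2 * n + 4) e i then Suc (key n e i) else 0)"

lemma marked_cong:
  assumes "\<And>k l. k < L \<Longrightarrow> l < L \<Longrightarrow> e (i + k) < e (i + l) \<longleftrightarrow> e' (j + k) < e' (j + l)" "L > 2"
  shows "marked L e i \<longleftrightarrow> marked L e' j"
proof -
  have 1: "(e (i + k) < e i) = (e' (j + k) < e' j)" if "k < L" for k
    using assms(1)[of k 0] assms(2) that by simp
  have 2: "(e (i + k) < e (i + 1)) = (e' (j + k) < e' (j + 1))" if "k < L" for k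
    using assms(1)[of k 1] assms(2) that by simp
  have 3: "(e (i + k) < e (i + (L - 2))) = (e' (j + k) < e' (j + (L - 2)))" if "k < L - 2" for k
    by (rule assms(1)) (use that in auto)
  have 4: "(e (i + (L - 1)) < e (i + k)) = (e' (j + (L - 1)) < e' (j + k))" if "k < L - 1" for k
    by (rule assms(1)) (use that in auto)
  show ?thesis unfolding marked_def
    by (intro conj_cong all_cong1 imp_cong refl; (elim conjE)?; rule 1 2 3 4; simp)
qed

text \<open>Scores depend on comparisons inside the window only. This lets them follow a window
  along edges and between rotations.\<close>

lemma score_cong:
  assumes "\<And>k l. k < 2 * n + 4 \<Longrightarrow> l < 2 * n + 4 \<Longrightarrow>
    e (i + k) < e (i + l) \<longleftrightarrow> e' (j + k) < e' (j + l)"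
  shows "score n e i = score n e' j"
proof -
  have "{k. k < n \<and> e (i + (2 + 2 * k)) < e (i + (3 + 2 * k))} =
        {k. k < n \<and> e' (j + (2 + 2 * k)) < e' (j + (3 + 2 * k))}"
    by (intro Collect_cong conj_cong refl assms) auto
  then have "key n e i = key n e' j" by (simp add: key_def)
  moreover have "marked (2 * n + 4) e i \<longleftrightarrow> marked (2 * n + 4) e' j"
    by (rule marked_cong) (use assms in auto)
  ultimately show ?thesis by (simp add: score_def)
qed

text \<open>The right window would place its start above entry L - 2 of the left one, against the
  third condition on the left. For t = 1 that start is the second largest entry on the left, where
  no contradiction arises; there the second entry of the right window is used.\<close>

lemma not_marked_overlap:
  assumes "marked L e i" "marked L e (i + t)" "1 \<le> t" "t \<le> L - 3" "5 \<le> L"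
  shows False
proof (cases "t = 1")
  case True
  have "e (i + t + (L - 3)) < e (i + t + 1)"
  proof -
    have "2 \<le> L - 3" "L - 3 < L" using assms(5) by auto
    then show ?thesis using assms(2) unfolding marked_def by blast
  qed
  moreover have "e (i + 2) < e (i + (L - 2))"
  proof -
    have "(2::nat) \<le> 2" "2 < L - 2" using assms(5) by auto
    then show ?thesis using assms(1) unfolding marked_def by blast
  qed
  moreover have "i + t + (L - 3) = i + (L - 2)" "i + t + 1 = i + 2" using True assms(5) by auto
  ultimately show False by simp
next
  case False
  have "e (i + t + (L - 2 - t)) < e (i + t)"
  proof -
    have "1 \<le> L - 2 - t" "L - 2 - t < L" using assms(3-5) by auto
    then show ?thesis using assms(2) unfolding marked_def by blast
  qed
  moreover have "e (i + t) < e (i + (L - 2))"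
  proof -
    have "2 \<le> t" "t < L - 2" using assms(3-5) False by auto
    then show ?thesis using assms(1) unfolding marked_def by blast
  qed
  moreover have "i + t + (L - 2 - t) = i + (L - 2)" using assms by auto
  ultimately show False by (metis less_asym)
qed

text \<open>The shared entry L - 1 is the smallest of the left window and the first or second
  largest of the right one. So all L - 2 pairs of positions mirrored at L - 1 descend.\<close>

lemma marked_glued:
  assumes "marked L e 0" "marked L e t" "t = L - 2 \<or> t = L - 1" "5 \<le> L" "1 \<le> k" "k \<le> L - 2"
  shows "e (L - 1 + k) < e (L - 1 - k)"
proof -
  have "L - 1 - k < L - 1" using assms(4-6) by auto
  then have "e (L - 1) < e (L - 1 - k)" using assms(1) unfolding marked_def by simp
  moreover have "e (L - 1 + k) < e (L - 1)"
    using assms(3)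
  proof
    assume t: "t = L - 2"
    have "2 \<le> k + 1" "k + 1 < L" using assms(4-6) by auto
    then have "e (t + (k + 1)) < e (t + 1)" using assms(2) unfolding marked_def by blast
    moreover have "t + (k + 1) = L - 1 + k" "t + 1 = L - 1" using t assms(4) by auto
    ultimately show ?thesis by simp
  next
    assume t: "t = L - 1"
    have "k < L" using assms(4-6) by auto
    then show ?thesis using assms(2,5) t unfolding marked_def by blast
  qed
  ultimately show ?thesis by simp
qed

text \<open>The permutations to delete. Ties count as maximal, so that outside this set some window
  strictly beats the first one; the price is the tie term of \<open>exceptional_set\<close>.\<close>

definition hitting_set :: "nat \<Rightarrow> nat \<Rightarrow> nat list set" where
  "hitting_set r n = {xs \<in> PSG_verts r.
     \<forall>i. i + (2 * n + 4) \<le> r \<longrightarrow> score n ((!) xs) i \<le> score n ((!) xs) 0}"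

text \<open>On a set where walks never get stuck, choose \<open>b\<close> with the largest score of
  the first window. Some window of \<open>b\<close> has a larger score, and walking on brings it to
  the front of another member.\<close>

lemma acyclic_outside_hitting_set:
  "acyclic (PSG_edges r \<inter> (PSG_verts r - hitting_set r n) \<times> (PSG_verts r - hitting_set r n))"
    (is "acyclic ?R")
proof (rule ccontr)
  assume "\<not> acyclic ?R"
  then obtain A where A: "A \<noteq> {}" "A \<subseteq> Field ?R" "\<And>b. b \<in> A \<Longrightarrow> \<exists>c\<in>A. (b, c) \<in> ?R"
    by (rule not_acyclic_core) blast
  have AS: "A \<subseteq> PSG_verts r - hitting_set r n" using A(2) by (auto simp: Field_def)
  have shift: "\<exists>c\<in>A. score n ((!) c) 0 = score n ((!) b) i"
    if "b \<in> A" "i + (2 * n + 4) \<le> r" for b i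
    using that
  proof (induction i arbitrary: b)
    case (Suc i)
    obtain c where c: "c \<in> A" "(b, c) \<in> PSG_edges r" using A(3)[OF Suc.prems(1)] by blast
    have "score n ((!) b) (Suc i) = score n ((!) c) i"
      by (rule score_cong) (use c(2) Suc.prems(2) in \<open>simp add: PSG_edges_iff\<close>)
    then show ?case using Suc.IH[OF c(1)] Suc.prems by simp
  qed auto
  have "finite A" using AS finite_subset[OF _ finite_PSG_verts] by blast
  then obtain b where b: "b \<in> A" "\<And>c. c \<in> A \<Longrightarrow> score n ((!) c) 0 \<le> score n ((!) b) 0"
    using A(1) obtains_MAX[of A "\<lambda>c. score n ((!) c) 0"] by (metis Max_ge finite_imageI imageI)
  have "b \<in> PSG_verts r" "b \<notin> hitting_set r n" using b AS by auto
  then obtain i where "i + (2 * n + 4) \<le> r" "score n ((!) b) 0 < score n ((!) b) i"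
    by (auto simp: hitting_set_def not_le)
  then show False using shift[OF b(1)] b(2) by (metis not_le)
qed

subsection \<open>Counting by permuting positions\<close>

lemma permute_list_PSG_verts:
  assumes "f permutes {..<r}" "xs \<in> PSG_verts r" shows "permute_list f xs \<in> PSG_verts r"
  using assms PSG_verts_length[OF assms(2)] by (simp add: PSG_verts_iff)

lemma inj_on_permute_list:
  assumes "f permutes {..<r}" shows "inj_on (permute_list f) (PSG_verts r)"
proof (rule inj_onI)
  fix xs ys assume xy: "xs \<in> PSG_verts r" "ys \<in> PSG_verts r" "permute_list f xs = permute_list f ys"
  then have l: "length xs = r" "length ys = r" by (auto simp: PSG_verts_length)
  show "xs = ys"
  proof (rule nth_equalityI)
    fix i assume "i < length xs"
    then have "i \<in> f ` {..<r}" using assms l by (simp add: permutes_image)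
    then obtain j where "j < r" "i = f j" by auto
    then show "xs ! i = ys ! i" using permute_list_nth[of f xs j] permute_list_nth[of f ys j] assms l xy(3) by simp
  qed (use l in simp)
qed

text \<open>\<open>\<tau>\<close> exchanges the partners \<open>p k\<close> and \<open>q k\<close>,
  and \<open>A\<close> selects the pairs to be exchanged. An explicit \<open>\<tau>\<close> avoids
  inverting \<open>p\<close> and \<open>q\<close>.\<close>

definition swap_pairs :: "(nat \<Rightarrow> nat) \<Rightarrow> (nat \<Rightarrow> nat) \<Rightarrow> (nat \<Rightarrow> nat) \<Rightarrow> nat set \<Rightarrow> nat \<Rightarrow> nat" where
  "swap_pairs \<tau> p q A i = (if i \<in> p ` A \<union> q ` A then \<tau> i else i)"

lemma swap_pairs_permutes:
  assumes "\<And>k. k \<in> A \<Longrightarrow> \<tau> (p k) = q k" "\<And>k. k \<in> A \<Longrightarrow> \<tau> (q k) = p k"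
    "\<And>k. k \<in> A \<Longrightarrow> p k < r" "\<And>k. k \<in> A \<Longrightarrow> q k < r"
  shows "swap_pairs \<tau> p q A permutes {..<r}"
proof -
  have inv: "swap_pairs \<tau> p q A (swap_pairs \<tau> p q A i) = i" for i
  proof -
    have "\<tau> i \<in> p ` A \<union> q ` A" "\<tau> (\<tau> i) = i" if "i \<in> p ` A \<union> q ` A"
      using that assms(1,2) by auto
    then show ?thesis unfolding swap_pairs_def by presburger
  qed
  show ?thesis unfolding permutes_def
  proof (intro conjI allI impI)
    fix i assume "i \<notin> {..<r}"
    then show "swap_pairs \<tau> p q A i = i" using assms(3,4) by (auto simp: swap_pairs_def)
  next
    fix i show "\<exists>!j. swap_pairs \<tau> p q A j = i" using inv by metis
  qed
qed

text \<open>Swapping the entries of any set of the given pairs shows that the signs of the pairs are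
  independent fair bits, also given any statistic \<open>g\<close> which the swaps preserve.\<close>

lemma card_prescribed_signs:
  assumes X: "X \<subseteq> PSG_verts r" and N: "finite N"
    and \<tau>: "\<And>k. k \<in> N \<Longrightarrow> \<tau> (p k) = q k" "\<And>k. k \<in> N \<Longrightarrow> \<tau> (q k) = p k"
    and lt: "\<And>k. k \<in> N \<Longrightarrow> p k < r" "\<And>k. k \<in> N \<Longrightarrow> q k < r"
    and inj: "inj_on p N" "inj_on q N" "p ` N \<inter> q ` N = {}"
    and sgn: "\<And>xs k. xs \<in> X \<Longrightarrow> k \<in> N \<Longrightarrow> xs ! p k < xs ! q k \<longleftrightarrow> k \<in> g xs"
    and g: "\<And>xs A. xs \<in> X \<Longrightarrow> A \<subseteq> N \<Longrightarrow> g (permute_list (swap_pairs \<tau> p q A) xs) = g xs"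
  shows "2 ^ card N * card X \<le> fact r"
proof -
  have perm: "swap_pairs \<tau> p q A permutes {..<r}" if "A \<subseteq> N" for A
    by (rule swap_pairs_permutes) (use that \<tau> lt in auto)
  \<comment> \<open>The swapped list reveals which pairs were swapped: exactly those whose sign now
    disagrees with the preserved statistic \<open>g\<close>.\<close>
  have flip: "A = {k \<in> N. (z ! p k < z ! q k) \<noteq> (k \<in> g z)}"
    if A: "A \<subseteq> N" and xs: "xs \<in> X" and z: "z = permute_list (swap_pairs \<tau> p q A) xs" for A xs z
  proof -
    have l: "length xs = r" "distinct xs" using xs X PSG_verts_length by (auto simp: PSG_verts_iff)
    have zn: "z ! i = xs ! swap_pairs \<tau> p q A i" if "i < r" for i
      unfolding z using permute_list_nth[of _ xs i] perm[OF A] l that by simp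
    have "(z ! p k < z ! q k) \<noteq> (k \<in> g z) \<longleftrightarrow> k \<in> A" if k: "k \<in> N" for k
    proof -
      have ne: "xs ! p k \<noteq> xs ! q k"
        using l lt[OF k] inj(3) k by (auto simp: nth_eq_iff_index_eq)
      have gz: "k \<in> g z \<longleftrightarrow> xs ! p k < xs ! q k" using g[OF xs A] sgn[OF xs k] z by simp
      show ?thesis
      proof (cases "k \<in> A")
        case True
        then have "z ! p k = xs ! q k" "z ! q k = xs ! p k"
          using zn lt[OF k] \<tau>[OF k] by (auto simp: swap_pairs_def)
        then show ?thesis using gz ne True by auto
      next
        case False
        then have "p k \<notin> p ` A \<union> q ` A" "q k \<notin> p ` A \<union> q ` A"
          using k A inj(3) inj_on_image_mem_iff[OF inj(1) k A] inj_on_image_mem_iff[OF inj(2) k A] by blast+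
        then have "z ! p k = xs ! p k" "z ! q k = xs ! q k"
          using zn lt[OF k] by (auto simp: swap_pairs_def)
        then show ?thesis using gz False by auto
      qed
    qed
    then show ?thesis using A by blast
  qed
  have "card (Pow N) * card X \<le> card (PSG_verts r)"
  proof (rule card_le_if_disjoint_images[where f = "\<lambda>A. permute_list (swap_pairs \<tau> p q A)"])
    show "inj_on (permute_list (swap_pairs \<tau> p q A)) X" if "A \<in> Pow N" for A
      using inj_on_permute_list[OF perm] that X inj_on_subset by blast
    show "permute_list (swap_pairs \<tau> p q A) xs \<in> PSG_verts r" if "A \<in> Pow N" "xs \<in> X" for A xs
      using permute_list_PSG_verts[OF perm] that X by blast
    show "A = B" if "A \<in> Pow N" "B \<in> Pow N" "xs \<in> X" "ys \<in> X"
      "permute_list (swap_pairs \<tau> p q A) xs = permute_list (swap_pairs \<tau> p q B) ys" for A B xs ys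
      by (rule trans[OF flip[OF PowD[OF that(1)] that(3) that(5)[symmetric]]
            flip[OF PowD[OF that(2)] that(4) refl, symmetric]])
  qed simp
  then show ?thesis using N by (simp add: card_Pow card_PSG_verts)
qed

lemma card_marked_glued:
  assumes L: "5 \<le> L" "2 * L \<le> r" and t: "t = L - 2 \<or> t = L - 1"
  shows "2 ^ (L - 2) * card {xs \<in> PSG_verts r. marked L ((!) xs) 0 \<and> marked L ((!) xs) t} \<le> fact r"
proof -
  have "2 ^ card {1..L - 2} * card {xs \<in> PSG_verts r. marked L ((!) xs) 0 \<and> marked L ((!) xs) t} \<le> fact r"
  \<comment> \<open>The pairs are mirrored at position L - 1 and all of them descend, hence the
    empty sign set.\<close>
  proof (rule card_prescribed_signs[where g = "\<lambda>_. {}" and p = "\<lambda>k. L - 1 - k" and q = "\<lambda>k. L - 1 + k"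
        and \<tau> = "\<lambda>i. 2 * (L - 1) - i"])
    show "xs ! (L - 1 - k) < xs ! (L - 1 + k) \<longleftrightarrow> k \<in> {}"
      if "xs \<in> {xs \<in> PSG_verts r. marked L ((!) xs) 0 \<and> marked L ((!) xs) t}" "k \<in> {1..L - 2}" for xs k
      using marked_glued[of L "(!) xs" t k] that t L by auto
  qed (use L in \<open>auto simp: inj_on_def\<close>)
  then show ?thesis by simp
qed

text \<open>The two windows are disjoint, so swaps in the later one leave the signs of the first
  unchanged; these serve as the preserved statistic.\<close>

lemma card_key_tie:
  assumes d: "2 * n + 4 \<le> d" "d + (2 * n + 4) \<le> r"
  shows "2 ^ n * card {xs \<in> PSG_verts r. key n ((!) xs) 0 = key n ((!) xs) d} \<le> fact r"
proof -
  define g where "g xs = {k. k < n \<and> xs ! (2 + 2 * k) < xs ! (3 + 2 * k)}" for xs :: "nat list"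
  have "2 ^ card {..<n} * card {xs \<in> PSG_verts r. key n ((!) xs) 0 = key n ((!) xs) d} \<le> fact r"
  proof (rule card_prescribed_signs[where g = g and p = "\<lambda>k. d + (2 + 2 * k)" and q = "\<lambda>k. d + (3 + 2 * k)"
        and \<tau> = "\<lambda>i. if even (i - d) then i + 1 else i - 1"])
    fix xs k assume xs: "xs \<in> {xs \<in> PSG_verts r. key n ((!) xs) 0 = key n ((!) xs) d}" and k: "k \<in> {..<n}"
    then have "g xs = {k. k < n \<and> xs ! (d + (2 + 2 * k)) < xs ! (d + (3 + 2 * k))}"
      unfolding g_def key_def by (simp add: set_encode_eq)
    then show "xs ! (d + (2 + 2 * k)) < xs ! (d + (3 + 2 * k)) \<longleftrightarrow> k \<in> g xs" using k by auto
  next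
    fix xs A assume xs: "xs \<in> {xs \<in> PSG_verts r. key n ((!) xs) 0 = key n ((!) xs) d}" and A: "A \<subseteq> {..<n}"
    let ?f = "swap_pairs (\<lambda>i. if even (i - d) then i + 1 else i - 1) (\<lambda>k. d + (2 + 2 * k)) (\<lambda>k. d + (3 + 2 * k)) A"
    have "?f permutes {..<r}" by (rule swap_pairs_permutes) (use A d in auto)
    then have "permute_list ?f xs ! i = xs ! i" if "i < d" for i
      using permute_list_nth[of ?f xs i] xs PSG_verts_length[of xs r] that d by (auto simp: swap_pairs_def)
    then show "g (permute_list ?f xs) = g xs" using d unfolding g_def
      by (intro Collect_cong conj_cong refl) auto
  qed (use d in \<open>auto simp: inj_on_def, presburger\<close>)
  then show ?thesis by simp
qed

subsection \<open>Disjoint blocks without a mark\<close>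

lemma swap_to_max:
  assumes K: "finite K" "K \<subseteq> {..<length xs}" "u \<in> K" and xs: "distinct (xs :: nat list)"
  obtains a where "a \<in> K" "\<And>k. k \<in> K \<Longrightarrow> k \<noteq> u \<Longrightarrow>
     permute_list (transpose u a) xs ! k < permute_list (transpose u a) xs ! u"
proof -
  have "Max ((!) xs ` K) \<in> (!) xs ` K" using K by (intro Max_in) auto
  then obtain a where a: "a \<in> K" "Max ((!) xs ` K) = xs ! a" by auto
  have perm: "transpose u a permutes {..<length xs}" using a K by (intro permutes_swap_id) auto
  have "permute_list (transpose u a) xs ! k < permute_list (transpose u a) xs ! u" if k: "k \<in> K" "k \<noteq> u" for k
  proof -
    have t: "transpose u a k \<in> K" "transpose u a k \<noteq> a"
      using k a K by (auto simp: transpose_def)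
    then have "xs ! transpose u a k \<le> xs ! a" using K a(2) by (metis Max_ge finite_imageI imageI)
    moreover have "xs ! transpose u a k \<noteq> xs ! a" using t a K xs by (subst nth_eq_iff_index_eq) auto
    ultimately show ?thesis
      using permute_list_nth[OF perm, of k] permute_list_nth[OF perm, of u] subsetD[OF K(2) k(1)]
        subsetD[OF K(2) K(3)] by (simp add: less_le)
  qed
  then show thesis using that a by blast
qed

lemma swap_to_min:
  assumes K: "finite K" "K \<subseteq> {..<length xs}" "u \<in> K" and xs: "distinct (xs :: nat list)"
  obtains a where "a \<in> K" "\<And>k. k \<in> K \<Longrightarrow> k \<noteq> u \<Longrightarrow>
     permute_list (transpose u a) xs ! u < permute_list (transpose u a) xs ! k"
proof -
  have "Min ((!) xs ` K) \<in> (!) xs ` K" using K by (intro Min_in) auto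
  then obtain a where a: "a \<in> K" "Min ((!) xs ` K) = xs ! a" by auto
  have perm: "transpose u a permutes {..<length xs}" using a K by (intro permutes_swap_id) auto
  have "permute_list (transpose u a) xs ! u < permute_list (transpose u a) xs ! k" if k: "k \<in> K" "k \<noteq> u" for k
  proof -
    have t: "transpose u a k \<in> K" "transpose u a k \<noteq> a"
      using k a K by (auto simp: transpose_def)
    then have "xs ! a \<le> xs ! transpose u a k" using K a(2) by (metis Min_le finite_imageI imageI)
    moreover have "xs ! transpose u a k \<noteq> xs ! a" using t a K xs by (subst nth_eq_iff_index_eq) auto
    ultimately show ?thesis
      using permute_list_nth[OF perm, of k] permute_list_nth[OF perm, of u] subsetD[OF K(2) k(1)]
        subsetD[OF K(2) K(3)] by (simp add: less_le)
  qed
  then show thesis using that a by blast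
qed

lemma permute_list_transpose_image:
  assumes "u \<in> K" "a \<in> K" "K \<subseteq> {..<length xs}"
  shows "k \<in> K \<Longrightarrow> permute_list (transpose u a) xs ! k \<in> (!) xs ` K"
    and "k < length xs \<Longrightarrow> k \<notin> K \<Longrightarrow> permute_list (transpose u a) xs ! k = xs ! k"
proof -
  have perm: "transpose u a permutes {..<length xs}" using assms by (intro permutes_swap_id) auto
  show "k \<in> K \<Longrightarrow> permute_list (transpose u a) xs ! k \<in> (!) xs ` K"
    using permute_list_nth[OF perm, of k] assms by (auto simp: transpose_def)
  show "k < length xs \<Longrightarrow> k \<notin> K \<Longrightarrow> permute_list (transpose u a) xs ! k = xs ! k"
    using permute_list_nth[OF perm, of k] assms by (auto simp: transpose_def)
qed

text \<open>Installing the largest entry, the second largest, the smallest and the third largest of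
  a block takes one transposition each. With the four partners inside the block this makes only L^4
  moves.\<close>

definition swaps :: "nat \<Rightarrow> nat \<Rightarrow> nat \<times> nat \<times> nat \<times> nat \<Rightarrow> nat list \<Rightarrow> nat list" where
  "swaps L s = (\<lambda>(a, b, c, d). permute_list (transpose (s + (L - 2)) d) \<circ>
     permute_list (transpose (s + (L - 1)) c) \<circ> permute_list (transpose (s + 1) b) \<circ> permute_list (transpose s a))"

lemma swaps_props:
  assumes L: "5 \<le> L" "s + L \<le> r" and abcd: "z \<in> {s..<s + L} \<times> {s..<s + L} \<times> {s..<s + L} \<times> {s..<s + L}"
  shows "xs \<in> PSG_verts r \<Longrightarrow> swaps L s z xs \<in> PSG_verts r"
    and "inj_on (swaps L s z) (PSG_verts r)"
    and "xs \<in> PSG_verts r \<Longrightarrow> i < s \<Longrightarrow> swaps L s z xs ! i = xs ! i"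
proof -
  obtain a b c d where z: "z = (a, b, c, d)" by (cases z)
  have p: "transpose (s + (L - 2)) d permutes {..<r}" "transpose (s + (L - 1)) c permutes {..<r}"
    "transpose (s + 1) b permutes {..<r}" "transpose s a permutes {..<r}"
    using L abcd by (auto simp: z intro!: permutes_swap_id)
  have sw: "swaps L s z = permute_list (transpose (s + (L - 2)) d) \<circ>
     permute_list (transpose (s + (L - 1)) c) \<circ> permute_list (transpose (s + 1) b) \<circ> permute_list (transpose s a)"
    by (simp add: swaps_def z)
  show "swaps L s z xs \<in> PSG_verts r" if "xs \<in> PSG_verts r"
    unfolding sw comp_def using p that by (intro permute_list_PSG_verts) auto
  have inj: "inj_on (permute_list f \<circ> h) (PSG_verts r)"
    if "f permutes {..<r}" "inj_on h (PSG_verts r)" "\<And>xs. xs \<in> PSG_verts r \<Longrightarrow> h xs \<in> PSG_verts r" for f h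
    using that by (intro comp_inj_on inj_on_subset[OF inj_on_permute_list[OF that(1)]]) auto
  show "inj_on (swaps L s z) (PSG_verts r)"
    unfolding sw comp_assoc
    by (intro inj p inj_on_permute_list) (auto simp: permute_list_PSG_verts p[simplified])
  have nth: "permute_list (transpose u v) ys ! i = ys ! i"
    if "ys \<in> PSG_verts r" "i < s" "u \<in> {s..<s + L}" "v \<in> {s..<s + L}" for u v ys i
    by (rule permute_list_transpose_image(2)[of u "{s..<s + L}" v ys i])
      (use that PSG_verts_length[of ys r] L in auto)
  have m: "s + (L - 2) \<in> {s..<s + L}" "s + (L - 1) \<in> {s..<s + L}" "s + 1 \<in> {s..<s + L}" "s \<in> {s..<s + L}"
    "a \<in> {s..<s + L}" "b \<in> {s..<s + L}" "c \<in> {s..<s + L}" "d \<in> {s..<s + L}"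
    using L abcd by (auto simp: z)
  show "swaps L s z xs ! i = xs ! i" if "xs \<in> PSG_verts r" "i < s"
  proof -
    note V1 = permute_list_PSG_verts[OF p(4) that(1)]
    note V2 = permute_list_PSG_verts[OF p(3) V1]
    note V3 = permute_list_PSG_verts[OF p(2) V2]
    show ?thesis unfolding sw comp_def
      using nth[OF V3 that(2) m(1,8)] nth[OF V2 that(2) m(2,7)] nth[OF V1 that(2) m(3,6)]
        nth[OF that m(4,5)] by (simp only:)
  qed
qed

lemma swaps_marked:
  assumes L: "5 \<le> L" "s + L \<le> r" and xs: "xs \<in> PSG_verts r"
  shows "\<exists>z\<in>{s..<s + L} \<times> {s..<s + L} \<times> {s..<s + L} \<times> {s..<s + L}. marked L ((!) (swaps L s z xs)) s"
proof -
  define K1 K2 K3 K4 where "K1 = {s..<s + L}" and "K2 = {s + 1..<s + L}" and "K3 = {s + 2..<s + L}"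
    and "K4 = {s + 2..<s + L - 1}"
  note K = K1_def K2_def K3_def K4_def
  have V: "permute_list (transpose u v) ys \<in> PSG_verts r" if "ys \<in> PSG_verts r" "u \<in> K1" "v \<in> K1" for u v ys
    using that L by (intro permute_list_PSG_verts permutes_swap_id) (auto simp: K)
  have im: "permute_list (transpose u v) ys ! k \<in> (!) ys ` K'" 
    if "ys \<in> PSG_verts r" "K' \<subseteq> K1" "u \<in> K'" "v \<in> K'" "k \<in> K'" for u v ys k K'
    by (rule permute_list_transpose_image(1)) (use that PSG_verts_length[of ys r] L in \<open>auto simp: K\<close>)
  have out: "permute_list (transpose u v) ys ! k = ys ! k" 
    if "ys \<in> PSG_verts r" "K' \<subseteq> K1" "u \<in> K'" "v \<in> K'" "k \<in> K1" "k \<notin> K'" for u v ys k K'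
    by (rule permute_list_transpose_image(2)[of _ K']) (use that PSG_verts_length[of ys r] L in \<open>auto simp: K\<close>)
  have pre: "finite K'" "K' \<subseteq> {..<length ys}" "distinct ys" if "ys \<in> PSG_verts r" "K' \<subseteq> K1" for ys K'
    using that PSG_verts_length[of ys r] L by (auto simp: K PSG_verts_iff finite_subset)
  have sub: "K2 \<subseteq> K1" "K3 \<subseteq> K1" "K4 \<subseteq> K1" "K3 \<subseteq> K2" "K4 \<subseteq> K3" by (auto simp: K)
  have mem: "s \<in> K1" "s + 1 \<in> K2" "s + (L - 1) \<in> K3" "s + (L - 2) \<in> K4" using L by (auto simp: K)
  obtain a where a: "a \<in> K1" "\<And>k. k \<in> K1 \<Longrightarrow> k \<noteq> s \<Longrightarrow>
     permute_list (transpose s a) xs ! k < permute_list (transpose s a) xs ! s"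
    using swap_to_max[OF pre(1,2)[OF xs order_refl] mem(1) pre(3)[OF xs order_refl]] by blast
  define x1 where "x1 = permute_list (transpose s a) xs"
  have x1: "x1 \<in> PSG_verts r" unfolding x1_def by (intro V xs mem a)
  obtain b where b: "b \<in> K2" "\<And>k. k \<in> K2 \<Longrightarrow> k \<noteq> s + 1 \<Longrightarrow>
     permute_list (transpose (s + 1) b) x1 ! k < permute_list (transpose (s + 1) b) x1 ! (s + 1)"
    using swap_to_max[OF pre(1,2)[OF x1 sub(1)] mem(2) pre(3)[OF x1 sub(1)]] by blast
  define x2 where "x2 = permute_list (transpose (s + 1) b) x1"
  have x2: "x2 \<in> PSG_verts r" unfolding x2_def using mem b sub by (intro V x1) auto
  obtain c where c: "c \<in> K3" "\<And>k. k \<in> K3 \<Longrightarrow> k \<noteq> s + (L - 1) \<Longrightarrow>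
     permute_list (transpose (s + (L - 1)) c) x2 ! (s + (L - 1)) < permute_list (transpose (s + (L - 1)) c) x2 ! k"
    using swap_to_min[OF pre(1,2)[OF x2 sub(2)] mem(3) pre(3)[OF x2 sub(2)]] by blast
  define x3 where "x3 = permute_list (transpose (s + (L - 1)) c) x2"
  have x3: "x3 \<in> PSG_verts r" unfolding x3_def using mem c sub by (intro V x2) auto
  obtain d where d: "d \<in> K4" "\<And>k. k \<in> K4 \<Longrightarrow> k \<noteq> s + (L - 2) \<Longrightarrow>
     permute_list (transpose (s + (L - 2)) d) x3 ! k < permute_list (transpose (s + (L - 2)) d) x3 ! (s + (L - 2))"
    using swap_to_max[OF pre(1,2)[OF x3 sub(3)] mem(4) pre(3)[OF x3 sub(3)]] by blast
  define x4 where "x4 = permute_list (transpose (s + (L - 2)) d) x3"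
  have im2: "x2 ! k \<in> (!) x1 ` K2" if "k \<in> K2" for k
    unfolding x2_def using im[OF x1 sub(1) mem(2) b(1) that] .
  have im3: "x3 ! k \<in> (!) x2 ` K3" if "k \<in> K3" for k
    unfolding x3_def using im[OF x2 sub(2) mem(3) c(1) that] .
  have im4: "x4 ! k \<in> (!) x3 ` K4" if "k \<in> K4" for k
    unfolding x4_def using im[OF x3 sub(3) mem(4) d(1) that] .
  have out2: "x2 ! k = x1 ! k" if "k \<in> K1" "k \<notin> K2" for k
    unfolding x2_def using out[OF x1 sub(1) mem(2) b(1) that] .
  have out3: "x3 ! k = x2 ! k" if "k \<in> K1" "k \<notin> K3" for k
    unfolding x3_def using out[OF x2 sub(2) mem(3) c(1) that] .
  have out4: "x4 ! k = x3 ! k" if "k \<in> K1" "k \<notin> K4" for k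
    unfolding x4_def using out[OF x3 sub(3) mem(4) d(1) that] .
  have im4': "x4 ! k \<in> (!) x3 ` K3" if "k \<in> K3" for k
    using im4[of k] out4[of k] that sub by (cases "k \<in> K4") auto
  have im43: "x4 ! k \<in> (!) x2 ` K3" if "k \<in> K3" for k
    using im4'[OF that] im3 by auto
  have eq0: "x4 ! s = x1 ! s" "s \<in> K1" using out2[of s] out3[of s] out4[of s] L by (auto simp: K)
  have eq1: "x4 ! (s + 1) = x2 ! (s + 1)" using out3[of "s + 1"] out4[of "s + 1"] L by (auto simp: K)
  have eqL: "x4 ! (s + (L - 1)) = x3 ! (s + (L - 1))" using out4[of "s + (L - 1)"] L by (auto simp: K)
  have lt1: "x1 ! k < x1 ! s" if "k \<in> K2" for k using a(2)[of k] that by (auto simp: x1_def K)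
  have lt2: "x2 ! k < x2 ! (s + 1)" if "k \<in> K3" for k using b(2)[of k] that by (auto simp: x2_def K)
  have lt3: "x3 ! (s + (L - 1)) < x3 ! k" if "k \<in> K4" for k using c(2)[of k] that by (auto simp: x3_def K)
  have lt4: "x4 ! k < x4 ! (s + (L - 2))" if "k \<in> K4" "k \<noteq> s + (L - 2)" for k
    using d(2)[of k] that by (simp add: x4_def)
  have A1: "x4 ! k < x4 ! (s + 1)" if "k \<in> K3" for k
    using im43[OF that] lt2 eq1 by auto
  have A2: "x2 ! k < x1 ! s" if "k \<in> K2" for k using im2[OF that] lt1 by auto
  have A0: "x4 ! k < x4 ! s" if "k \<in> K2" for k
  proof (cases "k \<in> K3")
    case True
    then show ?thesis using im43[OF True] A2 sub eq0 by auto
  next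
    case False
    then have "k = s + 1" using that by (auto simp: K)
    then show ?thesis using eq1 eq0 A2[OF mem(2)] by simp
  qed
  have AL: "x4 ! (s + (L - 1)) < x4 ! k" if "k \<in> K4" for k
    using im4[OF that] lt3 eqL by auto
  have "marked L ((!) x4) s"
    unfolding marked_def
  proof (intro conjI allI impI)
    fix k assume "1 \<le> k \<and> k < L"
    then show "x4 ! (s + k) < x4 ! s" by (intro A0) (auto simp: K)
  next
    fix k assume "2 \<le> k \<and> k < L"
    then show "x4 ! (s + k) < x4 ! (s + 1)" by (intro A1) (auto simp: K)
  next
    fix k assume "2 \<le> k \<and> k < L - 2"
    then show "x4 ! (s + k) < x4 ! (s + (L - 2))" by (intro lt4) (auto simp: K)
  next
    fix k assume k: "k < L - 1"
    consider "k = 0" | "k = 1" | "2 \<le> k" by linarith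
    then show "x4 ! (s + (L - 1)) < x4 ! (s + k)"
    proof cases
      case 1 then show ?thesis using A0[of "s + (L - 1)"] L by (auto simp: K)
    next
      case 2 then show ?thesis using A1[of "s + (L - 1)"] L by (auto simp: K)
    next
      case 3 then show ?thesis using k by (intro AL) (auto simp: K)
    qed
  qed
  moreover have "x4 = swaps L s (a, b, c, d) xs" by (simp add: swaps_def x1_def x2_def x3_def x4_def)
  moreover have "(a, b, c, d) \<in> {s..<s + L} \<times> {s..<s + L} \<times> {s..<s + L} \<times> {s..<s + L}"
    using a(1) b(1) c(1) d(1) sub by (auto simp: K)
  ultimately show ?thesis by metis
qed

text \<open>Among the permutations whose first b blocks are unmarked, at least a fraction L^-4 is
  marked at the next block: the moves that create the mark act inside that block and leave the
  earlier ones alone.\<close>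

lemma card_unmarked_blocks:
  assumes L: "5 \<le> L" "b * L \<le> r"
  shows "real (card {xs \<in> PSG_verts r. \<forall>c<b. \<not> marked L ((!) xs) (c * L)}) \<le> (1 - 1 / real L ^ 4) ^ b * fact r"
  using L(2)
proof (induction b)
  case 0
  then show ?case by (simp add: card_PSG_verts)
next
  case (Suc b)
  define X where "X = {xs \<in> PSG_verts r. \<forall>c<b. \<not> marked L ((!) xs) (c * L)}"
  define Y where "Y = {xs \<in> X. marked L ((!) xs) (b * L)}"
  let ?B = "{b * L..<b * L + L}"
  have s: "b * L + L \<le> r" using Suc.prems by simp
  have XV: "X \<subseteq> PSG_verts r" and fin: "finite X" by (auto simp: X_def)
  have "card X \<le> card (?B \<times> ?B \<times> ?B \<times> ?B) * card Y"
  proof (rule card_le_if_covered[where f = "swaps L (b * L)"])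
    show "inj_on (swaps L (b * L) z) X" if "z \<in> ?B \<times> ?B \<times> ?B \<times> ?B" for z
      using swaps_props(2)[OF L(1) s that] XV inj_on_subset by blast
    fix xs assume xs: "xs \<in> X"
    then have xV: "xs \<in> PSG_verts r" using XV by auto
    obtain z where z: "z \<in> ?B \<times> ?B \<times> ?B \<times> ?B" "marked L ((!) (swaps L (b * L) z xs)) (b * L)"
      using swaps_marked[OF L(1) s xV] by blast
    have "\<not> marked L ((!) (swaps L (b * L) z xs)) (c * L)" if c: "c < b" for c
    proof -
      have "c * L + L \<le> b * L" using c by (metis Suc_leI add.commute mult_Suc mult_le_mono1)
      then have "swaps L (b * L) z xs ! (c * L + k) = xs ! (c * L + k)" if "k < L" for k
        using swaps_props(3)[OF L(1) s z(1) xV, of "c * L + k"] that by simp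
      then have "marked L ((!) (swaps L (b * L) z xs)) (c * L) \<longleftrightarrow> marked L ((!) xs) (c * L)"
        using L(1) by (intro marked_cong) auto
      then show ?thesis using xs c by (simp add: X_def)
    qed
    then have "swaps L (b * L) z xs \<in> Y"
      using z swaps_props(1)[OF L(1) s z(1) xV] by (simp add: X_def Y_def)
    then show "\<exists>z\<in>?B \<times> ?B \<times> ?B \<times> ?B. swaps L (b * L) z xs \<in> Y" using z by blast
  qed (use fin in \<open>auto simp: Y_def\<close>)
  then have "card X \<le> L ^ 4 * card Y" by (simp add: card_cartesian_product power4_eq_xxxx mult.assoc)
  then have "real (card X) \<le> real L ^ 4 * real (card Y)" by (metis of_nat_le_iff of_nat_mult of_nat_power)
  then have Y: "real (card X) / real L ^ 4 \<le> real (card Y)" using L(1) by (simp add: field_simps)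
  have "{xs \<in> PSG_verts r. \<forall>c<Suc b. \<not> marked L ((!) xs) (c * L)} = X - Y"
    by (auto simp: X_def Y_def less_Suc_eq)
  moreover have "card (X - Y) = card X - card Y" "card Y \<le> card X"
    using fin by (auto simp: Y_def card_Diff_subset card_mono)
  ultimately have "real (card {xs \<in> PSG_verts r. \<forall>c<Suc b. \<not> marked L ((!) xs) (c * L)}) = real (card X) - real (card Y)"
    by (simp add: of_nat_diff)
  also have "\<dots> \<le> (1 - 1 / real L ^ 4) * real (card X)" using Y by (simp add: algebra_simps)
  also have "\<dots> \<le> (1 - 1 / real L ^ 4) * ((1 - 1 / real L ^ 4) ^ b * fact r)"
    using Suc.IH Suc.prems L(1) by (intro mult_left_mono) (auto simp: X_def)
  finally show ?case by simp
qed

text \<open>No mark at all, two marks overlapping in two or in one position, or equal keys of two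
  disjoint windows. The ties are collected regardless of marks, so that only the signs of pairs have
  to be counted.\<close>

definition exceptional_set :: "nat \<Rightarrow> nat \<Rightarrow> nat list set" where
  "exceptional_set r n =
     {xs \<in> PSG_verts r. \<forall>i. i + (2 * n + 4) \<le> r \<longrightarrow> \<not> marked (2 * n + 4) ((!) xs) i} \<union>
     {xs \<in> PSG_verts r. marked (2 * n + 4) ((!) xs) 0 \<and> marked (2 * n + 4) ((!) xs) (2 * n + 4 - 2)} \<union>
     {xs \<in> PSG_verts r. marked (2 * n + 4) ((!) xs) 0 \<and> marked (2 * n + 4) ((!) xs) (2 * n + 4 - 1)} \<union>
     (\<Union>d\<in>{2 * n + 4..r - (2 * n + 4)}. {xs \<in> PSG_verts r. key n ((!) xs) 0 = key n ((!) xs) d})"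

lemma card_exceptional_set:
  assumes n: "n \<ge> 1" and r: "2 * (2 * n + 4) \<le> r"
  shows "real (card (exceptional_set r n)) \<le>
     ((1 - 1 / real (2 * n + 4) ^ 4) ^ (r div (2 * n + 4)) + (real r + 2) / 2 ^ n) * fact r"
proof -
  define L where "L = 2 * n + 4"
  define Z G T where "Z = {xs \<in> PSG_verts r. \<forall>i. i + L \<le> r \<longrightarrow> \<not> marked L ((!) xs) i}"
    and "G t = {xs \<in> PSG_verts r. marked L ((!) xs) 0 \<and> marked L ((!) xs) t}"
    and "T d = {xs \<in> PSG_verts r. key n ((!) xs) 0 = key n ((!) xs) d}" for t d
  have L: "5 \<le> L" "2 * L \<le> r" using n r by (auto simp: L_def)
  have fin: "finite (G t)" "finite (T d)" "finite Z" for t d by (auto simp: G_def T_def Z_def)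
  have "Z \<subseteq> {xs \<in> PSG_verts r. \<forall>c<r div L. \<not> marked L ((!) xs) (c * L)}"
  proof -
    have "c * L + L \<le> r" if "c < r div L" for c
    proof -
      have "Suc c * L \<le> r div L * L" using that by (intro mult_le_mono1) simp
      also have "\<dots> \<le> r" by simp
      finally show ?thesis by simp
    qed
    then show ?thesis by (auto simp: Z_def)
  qed
  then have "card Z \<le> card {xs \<in> PSG_verts r. \<forall>c<r div L. \<not> marked L ((!) xs) (c * L)}"
    by (intro card_mono) auto
  then have "real (card Z) \<le> real (card {xs \<in> PSG_verts r. \<forall>c<r div L. \<not> marked L ((!) xs) (c * L)})"
    by simp
  also have "\<dots> \<le> (1 - 1 / real L ^ 4) ^ (r div L) * fact r"
    by (rule card_unmarked_blocks[OF L(1)]) simp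
  finally have Z: "real (card Z) \<le> (1 - 1 / real L ^ 4) ^ (r div L) * fact r" .
  \<comment> \<open>Weakening all bounds to 2^-n treats the two overlaps and the at most r ties
    alike, which explains the factor r + 2.\<close>
  have half: "real c \<le> fact r / 2 ^ n" if "2 ^ m * c \<le> fact r" "n \<le> m" for c m :: nat
  proof -
    have "2 ^ n * c \<le> 2 ^ m * c" using that(2) by (intro mult_le_mono1 power_increasing) auto
    then have "2 ^ n * c \<le> fact r" using that(1) by linarith
    then have "real (2 ^ n * c) \<le> real (fact r)" by (simp only: of_nat_le_iff)
    then show ?thesis by (simp add: field_simps)
  qed
  have G: "real (card (G t)) \<le> fact r / 2 ^ n" if "t = L - 2 \<or> t = L - 1" for t
    using half[OF card_marked_glued[OF L that]] by (simp add: G_def L_def)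
  have T: "real (card (T d)) \<le> fact r / 2 ^ n" if "d \<in> {L..r - L}" for d
  proof -
    have "L \<le> d" "d + L \<le> r" using that L(2) by auto
    then show ?thesis using half[OF card_key_tie[of n d r]] by (simp add: T_def L_def)
  qed
  have ex: "exceptional_set r n = Z \<union> G (L - 2) \<union> G (L - 1) \<union> (\<Union>d\<in>{L..r - L}. T d)"
    by (simp add: exceptional_set_def Z_def G_def T_def L_def)
  have "card (exceptional_set r n) \<le> card Z + card (G (L - 2)) + card (G (L - 1)) + card (\<Union>d\<in>{L..r - L}. T d)"
    unfolding ex using card_Un_le[of "Z \<union> G (L - 2) \<union> G (L - 1)" "\<Union>d\<in>{L..r - L}. T d"]
      card_Un_le[of "Z \<union> G (L - 2)" "G (L - 1)"] card_Un_le[of Z "G (L - 2)"] by linarith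
  also have "card (\<Union>d\<in>{L..r - L}. T d) \<le> (\<Sum>d\<in>{L..r - L}. card (T d))" by (rule card_UN_le) simp
  finally have "real (card (exceptional_set r n)) \<le>
      real (card Z + card (G (L - 2)) + card (G (L - 1)) + (\<Sum>d\<in>{L..r - L}. card (T d)))"
    by (simp only: of_nat_le_iff)
  then have "real (card (exceptional_set r n)) \<le>
      real (card Z) + real (card (G (L - 2))) + real (card (G (L - 1))) + (\<Sum>d\<in>{L..r - L}. real (card (T d)))"
    by simp
  also have "(\<Sum>d\<in>{L..r - L}. real (card (T d))) \<le> real (card {L..r - L}) * (fact r / 2 ^ n)"
    by (rule sum_bounded_above) (rule T)
  also have "real (card {L..r - L}) * (fact r / 2 ^ n) \<le> real r * (fact r / 2 ^ n)"
    using L by (intro mult_right_mono) auto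
  finally have "real (card (exceptional_set r n)) \<le>
      (1 - 1 / real L ^ 4) ^ (r div L) * fact r + fact r / 2 ^ n + fact r / 2 ^ n + real r * (fact r / 2 ^ n)"
    using Z G[of "L - 2"] G[of "L - 1"] by simp
  also have "\<dots> = ((1 - 1 / real L ^ 4) ^ (r div L) + (real r + 2) / 2 ^ n) * fact r"
    by (simp add: field_simps)
  finally show ?thesis unfolding L_def .
qed

text \<open>Two rotations of the same permutation which both have a maximal score at the start see each
  other, unless their windows overlap.\<close>

lemma hitting_set_rotations:
  assumes n: "n \<ge> 1" and r: "2 * (2 * n + 4) \<le> r" and d: "0 < d" "d < r"
    and xs: "xs \<in> hitting_set r n - exceptional_set r n"
    and ys: "rotate d xs \<in> hitting_set r n - exceptional_set r n"
  shows False
proof -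
  define L where "L = 2 * n + 4"
  define ys where "ys = rotate d xs"
  have L: "5 \<le> L" "2 * L \<le> r" using n r by (auto simp: L_def)
  have V: "xs \<in> PSG_verts r" "ys \<in> PSG_verts r" using xs ys by (auto simp: hitting_set_def ys_def)
  have l: "length xs = r" "length ys = r" using V by (auto simp: PSG_verts_length)
  \<comment> \<open>Some window is marked, so the maximal score is positive, and the first window
    attains it.\<close>
  have start: "marked L ((!) zs) 0" if zs: "zs \<in> hitting_set r n - exceptional_set r n" for zs
  proof -
    have "zs \<in> PSG_verts r" using zs by (auto simp: hitting_set_def)
    then obtain i where i: "i + L \<le> r" "marked L ((!) zs) i"
      using zs by (auto simp: exceptional_set_def L_def)
    then have "0 < score n ((!) zs) i" by (simp add: score_def L_def)
    also have "\<dots> \<le> score n ((!) zs) 0" using zs i by (auto simp: hitting_set_def L_def)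
    finally show ?thesis by (simp add: score_def L_def split: if_splits)
  qed
  have mx: "marked L ((!) xs) 0" and my: "marked L ((!) ys) 0" using start xs ys by (auto simp: ys_def)
  have apart: "L \<le> t" if "zs \<in> hitting_set r n - exceptional_set r n" "marked L ((!) zs) t" "0 < t" for zs t
  proof (rule ccontr)
    assume "\<not> L \<le> t"
    then consider "t \<le> L - 3" | "t = L - 2" | "t = L - 1" by linarith
    then show False
    proof cases
      case 1
      then show False using not_marked_overlap[of L "(!) zs" 0 t] start[OF that(1)] that L by simp
    next
      case 2
      then have "zs \<in> exceptional_set r n" using that start[OF that(1)]
        by (auto simp: exceptional_set_def L_def hitting_set_def)
      then show False using that by simp
    next
      case 3
      then have "zs \<in> exceptional_set r n" using that start[OF that(1)]
        by (auto simp: exceptional_set_def L_def hitting_set_def)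
      then show False using that by simp
    qed
  qed
  have yn: "ys ! k = xs ! (d + k)" if "d + k < r" for k
    using that l d by (simp add: ys_def nth_rotate)
  have xn: "ys ! (r - d + k) = xs ! k" if "k < d" for k
    using that l d by (simp add: ys_def nth_rotate)
  \<comment> \<open>Cyclically the starts of \<open>xs\<close> and \<open>ys\<close> are d and r - d
    apart. If both distances are at least L, each list contains the other's first window and the
    scores tie; otherwise two marks in one of the lists are too close.\<close>
  consider "d + L \<le> r" "L \<le> d" | "d < L" | "r < d + L" by linarith
  then show False
  proof cases
    case 1
    have sx: "score n ((!) xs) d = score n ((!) ys) 0"
      by (rule score_cong) (use yn 1 in \<open>auto simp: L_def\<close>)
    have sy: "score n ((!) ys) (r - d) = score n ((!) xs) 0"
      by (rule score_cong) (use xn 1 in \<open>auto simp: L_def\<close>)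
    have "score n ((!) xs) d \<le> score n ((!) xs) 0" "score n ((!) ys) (r - d) \<le> score n ((!) ys) 0"
      using xs ys 1 by (auto simp: hitting_set_def L_def ys_def[symmetric])
    then have eq: "score n ((!) xs) d = score n ((!) xs) 0" using sx sy by simp
    then have "key n ((!) xs) 0 = key n ((!) xs) d" using mx by (auto simp: score_def L_def split: if_splits)
    then have "xs \<in> exceptional_set r n" using V 1 by (auto simp: exceptional_set_def L_def)
    then show False using xs by simp
  next
    case 2
    then have "marked L ((!) xs) d \<longleftrightarrow> marked L ((!) ys) 0"
      using yn L by (intro marked_cong) auto
    then show False using apart[OF xs, of d] my d 2 by simp
  next
    case 3
    then have "marked L ((!) ys) (r - d) \<longleftrightarrow> marked L ((!) xs) 0"
      using xn L by (intro marked_cong) auto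
    then show False using apart[OF ys, of "r - d"] mx d 3 by (simp add: ys_def)
  qed
qed

text \<open>Each rotation class has at most one such member, so the r rotated copies of the set are
  disjoint.\<close>

lemma card_hitting_set:
  assumes n: "n \<ge> 1" and r: "2 * (2 * n + 4) \<le> r"
  shows "r * card (hitting_set r n - exceptional_set r n) \<le> fact r"
proof -
  let ?X = "hitting_set r n - exceptional_set r n"
  have "card {..<r} * card ?X \<le> card (PSG_verts r)"
  proof (rule card_le_if_disjoint_images[where f = rotate])
    have less: False if "i < j" "j < r" "xs \<in> ?X" "ys \<in> ?X" "rotate i xs = rotate j ys" for i j xs ys
    proof -
      have "rotate i xs = rotate i (rotate (j - i) ys)" using that by (simp add: rotate_rotate)
      then have "xs = rotate (j - i) ys" using inj_rotate by (metis injD)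
      then show False using hitting_set_rotations[OF n r, of "j - i" ys] that
        by (simp add: less_imp_diff_less)
    qed
    show "i = j" if "i \<in> {..<r}" "j \<in> {..<r}" "xs \<in> ?X" "ys \<in> ?X" "rotate i xs = rotate j ys" for i j xs ys
      using less[of i j xs ys] less[of j i ys xs] that by (metis lessThan_iff linorder_neqE_nat)
  qed (auto simp: hitting_set_def intro: inj_on_subset[OF inj_rotate])
  then show ?thesis by (simp add: card_PSG_verts)
qed

lemma max_acyclic_lower:
  assumes n: "n \<ge> 1" and r: "2 * (2 * n + 4) \<le> r"
  shows "1 - 1 / real r - ((1 - 1 / real (2 * n + 4) ^ 4) ^ (r div (2 * n + 4)) + (real r + 2) / 2 ^ n)
     \<le> real (max_acyclic (PSG_verts r) (PSG_edges r)) / fact r"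
proof -
  define D where "D = hitting_set r n"
  define B where "B = exceptional_set r n"
  define err where "err = (1 - 1 / real (2 * n + 4) ^ 4) ^ (r div (2 * n + 4)) + (real r + 2) / 2 ^ n"
  have r0: "r > 0" using r by simp
  have DV: "D \<subseteq> PSG_verts r" by (auto simp: D_def hitting_set_def)
  then have finD: "finite D" by (rule finite_subset) simp
  have "card (PSG_verts r - D) \<le> max_acyclic (PSG_verts r) (PSG_edges r)"
    unfolding D_def by (intro max_acyclic_ge acyclic_outside_hitting_set) auto
  moreover have "card (PSG_verts r - D) + card D = fact r"
    using DV finD card_mono[OF _ DV] by (simp add: card_Diff_subset card_PSG_verts)
  ultimately have "fact r \<le> max_acyclic (PSG_verts r) (PSG_edges r) + card D" by linarith
  then have "real (fact r) \<le> real (max_acyclic (PSG_verts r) (PSG_edges r) + card D)"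
    by (simp only: of_nat_le_iff)
  then have 1: "(fact r :: real) \<le> real (max_acyclic (PSG_verts r) (PSG_edges r)) + real (card D)"
    by simp
  have "finite B" by (auto simp: B_def exceptional_set_def)
  then have "card D \<le> card ((D - B) \<union> B)" using finD by (intro card_mono) auto
  then have "card D \<le> card (D - B) + card B" using card_Un_le[of "D - B" B] by linarith
  moreover have "real (r * card (D - B)) \<le> real (fact r)"
    using card_hitting_set[OF n r] unfolding B_def D_def by (simp only: of_nat_le_iff)
  then have "real (card (D - B)) \<le> fact r / real r" using r0 by (simp add: field_simps)
  moreover have "real (card B) \<le> err * fact r" using card_exceptional_set[OF n r] by (simp add: B_def err_def)
  ultimately have "real (card D) \<le> fact r / real r + err * fact r" by linarith
  with 1 have "(1 - 1 / real r - err) * fact r \<le> real (max_acyclic (PSG_verts r) (PSG_edges r))"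
    by (simp add: algebra_simps)
  then show ?thesis by (simp add: err_def pos_le_divide_eq)
qed

section \<open>Asymptotics of the error term\<close>

lemma error_bound:
  obtains r0 :: nat where "\<And>r. r \<ge> r0 \<Longrightarrow> \<exists>n\<ge>1. 2 * (2 * n + 4) \<le> r \<and>
     (1 - 1 / real (2 * n + 4) ^ 4) ^ (r div (2 * n + 4)) + (real r + 2) / 2 ^ n \<le> 1 / (real r)\<^sup>2"
proof -
  \<comment> \<open>Any positive exponent below 1/5 works: r / L^5 must outgrow ln r, and 2^n must
    outgrow r^3.\<close>
  define x where "x r = real r powr (1 / 8)" for r
  have "\<forall>\<^sub>F r in sequentially. 2 \<le> x r" unfolding x_def by real_asymp
  moreover have "\<forall>\<^sub>F r in sequentially. 2 * (2 * x r + 4) \<le> real r" unfolding x_def by real_asymp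
  \<comment> \<open>This is a smooth majorant of the error: the exponent 1 - x absorbs the floor in
    n, and the -1 absorbs the rounding in \<open>r div L\<close>.\<close>
  moreover have "\<forall>\<^sub>F r in sequentially.
      exp (- ((real r / (2 * x r + 4) - 1) / (2 * x r + 4) ^ 4)) + (real r + 2) * 2 powr (1 - x r) \<le> 1 / (real r)\<^sup>2"
    unfolding x_def by real_asymp
  ultimately have "\<forall>\<^sub>F r in sequentially. 2 \<le> x r \<and> 2 * (2 * x r + 4) \<le> real r \<and>
      exp (- ((real r / (2 * x r + 4) - 1) / (2 * x r + 4) ^ 4)) + (real r + 2) * 2 powr (1 - x r) \<le> 1 / (real r)\<^sup>2"
    by eventually_elim simp
  then obtain r0 where r0: "\<And>r. r \<ge> r0 \<Longrightarrow> 2 \<le> x r \<and> 2 * (2 * x r + 4) \<le> real r \<and>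
      exp (- ((real r / (2 * x r + 4) - 1) / (2 * x r + 4) ^ 4)) + (real r + 2) * 2 powr (1 - x r) \<le> 1 / (real r)\<^sup>2"
    by (auto simp: eventually_sequentially)
  show thesis
  proof (rule that)
    fix r assume "r0 \<le> r"
    note r = r0[OF this, THEN conjunct1] r0[OF this, THEN conjunct2, THEN conjunct1]
      r0[OF this, THEN conjunct2, THEN conjunct2]
    define n where "n = nat \<lfloor>x r\<rfloor>"
    define L where "L = 2 * n + 4"
    have n: "real n \<le> x r" "x r - 1 \<le> real n" using r by (auto simp: n_def)
    have n1: "1 \<le> n" using r by (simp add: n_def le_nat_floor)
    have Lx: "real L \<le> 2 * x r + 4" "0 < real L" using n by (auto simp: L_def)
    have "real (2 * L) \<le> real r" using Lx(1) r(2) by simp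
    then have Lr: "2 * L \<le> r" by (simp only: of_nat_le_iff)
    have "1 - 1 / real L ^ 4 \<le> exp (- (1 / real L ^ 4))" using exp_ge_add_one_self[of "- (1 / real L ^ 4)"] by simp
    moreover have "0 \<le> 1 - 1 / real L ^ 4" using Lx by (simp add: L_def)
    ultimately have "(1 - 1 / real L ^ 4) ^ (r div L) \<le> exp (- (1 / real L ^ 4)) ^ (r div L)"
      by (rule power_mono)
    also have "\<dots> = exp (- (real (r div L) / real L ^ 4))" by (simp flip: exp_of_nat_mult)
    also have "\<dots> \<le> exp (- ((real r / (2 * x r + 4) - 1) / (2 * x r + 4) ^ 4))"
    proof -
      have "real r / (2 * x r + 4) - 1 \<le> real r / real L - 1"
        using Lx by (intro diff_right_mono divide_left_mono) (auto intro!: mult_pos_pos)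
      also have "real r / real L - 1 \<le> real (r div L)"
      proof -
        have "r div L * L + r mod L = r" by (rule div_mult_mod_eq)
        moreover have "r mod L < L" using Lx(2) by simp
        ultimately have "r \<le> (r div L + 1) * L" unfolding add_mult_distrib by linarith
        then have "real r \<le> real ((r div L + 1) * L)" by (simp only: of_nat_le_iff)
        then show ?thesis using Lx(2) by (simp add: field_simps)
      qed
      finally have "(real r / (2 * x r + 4) - 1) / (2 * x r + 4) ^ 4 \<le> real (r div L) / real L ^ 4"
        using Lx by (intro frac_le power_mono) auto
      then show ?thesis by simp
    qed
    finally have 1: "(1 - 1 / real L ^ 4) ^ (r div L) \<le> exp (- ((real r / (2 * x r + 4) - 1) / (2 * x r + 4) ^ 4))" .
    have "(real r + 2) / 2 ^ n = (real r + 2) * 2 powr (- real n)"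
      by (simp add: powr_minus powr_realpow divide_inverse)
    also have "\<dots> \<le> (real r + 2) * 2 powr (1 - x r)" using n by (intro mult_left_mono powr_mono) auto
    finally have 2: "(real r + 2) / 2 ^ n \<le> (real r + 2) * 2 powr (1 - x r)" .
    have "(1 - 1 / real L ^ 4) ^ (r div L) + (real r + 2) / 2 ^ n \<le> 1 / (real r)\<^sup>2" using 1 2 r by linarith
    then show "\<exists>n\<ge>1. 2 * (2 * n + 4) \<le> r \<and>
     (1 - 1 / real (2 * n + 4) ^ 4) ^ (r div (2 * n + 4)) + (real r + 2) / 2 ^ n \<le> 1 / (real r)\<^sup>2"
      using n1 Lr unfolding L_def by blast
  qed
qed

lemma ln_ratio_ge:
  assumes "r \<ge> (3::nat)"
  shows "1 / (real r)\<^sup>2 \<le> ln (real r) / ((real r)\<^sup>2 * ln (ln (real r)))"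
proof -
  \<comment> \<open>This leads to e < 3, so that ln (ln r) is positive from r = 3 on.\<close>
  have "(9 / 10) ^ 10 \<le> exp (- (1 / 10) :: real) ^ 10"
    using exp_ge_add_one_self[of "- (1 / 10) :: real"] by (intro power_mono) auto
  also have "\<dots> = exp (- 1)" by (simp flip: exp_of_nat_mult)
  also have "\<dots> = 1 / exp (1::real)" by (simp add: exp_minus divide_inverse)
  finally have "exp 1 * (9 / 10) ^ 10 \<le> (1::real)" by (simp add: pos_le_divide_eq mult.commute)
  then have "exp 1 < (3::real)" by (simp add: power_divide)
  then have "exp 1 < real r" using assms by linarith
  then have l: "1 < ln (real r)" using assms by (metis exp_gt_zero ln_exp ln_less_cancel_iff order_less_trans)
  then have "0 < ln (ln (real r))" by simp
  moreover have "ln (ln (real r)) \<le> ln (real r)" using l ln_le_minus_one[of "ln (real r)"] by linarith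
  ultimately have "1 \<le> ln (real r) / ln (ln (real r))" by simp
  then have "1 / (real r)\<^sup>2 \<le> (ln (real r) / ln (ln (real r))) / (real r)\<^sup>2" by (intro divide_right_mono) auto
  then show ?thesis by (simp add: mult.commute)
qed

theorem corollary13:
  "\<exists>C::real. C > 0 \<and> (\<forall>r::nat. r \<ge> 3 \<longrightarrow>
     1 - 1 / real r - C * (ln (real r) / ((real r)\<^sup>2 * ln (ln (real r))))
       \<le> real (max_acyclic (PSG_verts r) (PSG_edges r)) / fact r \<and>
     real (max_acyclic (PSG_verts r) (PSG_edges r)) / fact r
       \<le> 1 - 1 / real r - real (totient r) / fact r \<and>
     real (growing_threshold r)
       \<in> {(1 - 1 / real r - C * (ln (real r) / ((real r)\<^sup>2 * ln (ln (real r))))) * fact r ..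
          (1 - 1 / real r - (real (totient r) - 1) / fact r) * fact r})"
proof -
  obtain r0 :: nat where r0: "\<And>r. r \<ge> r0 \<Longrightarrow> \<exists>n\<ge>1. 2 * (2 * n + 4) \<le> r \<and>
     (1 - 1 / real (2 * n + 4) ^ 4) ^ (r div (2 * n + 4)) + (real r + 2) / 2 ^ n \<le> 1 / (real r)\<^sup>2"
    by (rule error_bound) blast
  \<comment> \<open>For r below \<open>r0\<close> the value C / r^2 is at least 1 and the lower
    bound is trivial; for the other r only C >= 1 matters.\<close>
  define C where "C = (real r0)\<^sup>2 + 1"
  have C: "C \<ge> 1" by (simp add: C_def)
  show ?thesis
  proof (intro exI[of _ C] conjI allI impI)
    show "C > 0" using C by linarith
    fix r :: nat assume r: "r \<ge> 3"
    let ?a = "max_acyclic (PSG_verts r) (PSG_edges r)"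
    let ?q = "ln (real r) / ((real r)\<^sup>2 * ln (ln (real r)))"
    have q: "1 / (real r)\<^sup>2 \<le> ?q" by (rule ln_ratio_ge[OF r])
    have q0: "0 \<le> ?q" by (rule order_trans[OF _ q]) simp
    show lower: "1 - 1 / real r - C * ?q \<le> real ?a / fact r"
    proof (cases "r0 \<le> r")
      case True
      then obtain n where n: "1 \<le> n" "2 * (2 * n + 4) \<le> r"
        "(1 - 1 / real (2 * n + 4) ^ 4) ^ (r div (2 * n + 4)) + (real r + 2) / 2 ^ n \<le> 1 / (real r)\<^sup>2"
        using r0 by blast
      have "?q \<le> C * ?q" using mult_right_mono[OF C q0] by simp
      then show ?thesis using max_acyclic_lower[OF n(1,2)] n(3) q by linarith
    next
      case False
      then have "1 \<le> (real r0)\<^sup>2 / (real r)\<^sup>2" using r by simp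
      also have "\<dots> \<le> C * (1 / (real r)\<^sup>2)" by (simp add: C_def divide_right_mono)
      also have "\<dots> \<le> C * ?q" using q C by (intro mult_left_mono) auto
      finally have "1 \<le> C * ?q" .
      moreover have "0 \<le> real ?a / fact r" "0 \<le> 1 / real r" by simp_all
      ultimately show ?thesis by linarith
    qed
    obtain S where S: "S \<subseteq> PSG_verts r" "acyclic (PSG_edges r \<inter> S \<times> S)" "card S = ?a"
      by (rule max_acyclic_witness[OF finite_PSG_verts])
    have up: "r * ?a + fact r + r * totient r \<le> r * fact r"
      using acyclic_card_upper[of r S] S r by simp
    then have "real (r * ?a + fact r + r * totient r) \<le> real (r * fact r)" by (simp only: of_nat_le_iff)
    then have "real r * real ?a \<le> real r * ((1 - 1 / real r) * fact r - real (totient r))"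
      using r by (simp add: algebra_simps)
    then have up': "real ?a \<le> (1 - 1 / real r) * fact r - real (totient r)" using r by simp
    then have "real ?a / fact r \<le> ((1 - 1 / real r) * fact r - real (totient r)) / fact r"
      by (rule divide_right_mono) simp
    then show "real ?a / fact r \<le> 1 - 1 / real r - real (totient r) / fact r"
      by (simp add: diff_divide_distrib)
    have "r * ?a < r * fact r" using up fact_gt_zero[of r, where 'a = nat] by linarith
    then have "?a < fact r" by simp
    \<comment> \<open>The threshold is one more than the maximum, hence totient(r) - 1 instead of
      totient(r) in its upper bound.\<close>
    then have "growing_threshold r = ?a + 1" using r by (intro growing_threshold_eq) auto
    moreover have "(1 - 1 / real r - C * ?q) * fact r \<le> real ?a" using lower by (simp add: pos_le_divide_eq)
    moreover have "(1 - 1 / real r - (real (totient r) - 1) / fact r) * fact r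
        = (1 - 1 / real r) * fact r - real (totient r) + 1"
      by (simp only: left_diff_distrib) simp
    ultimately show "real (growing_threshold r)
       \<in> {(1 - 1 / real r - C * ?q) * fact r .. (1 - 1 / real r - (real (totient r) - 1) / fact r) * fact r}"
      using up' by simp
  qed
qed

end
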